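(* Let $n$ and $k$ be integers with $2\le k\le n-2$, and let $A\subseteq[n]$ be non-adjacent. Then $D_{k,n}(A)$ is the $\mathsf{Le}$-diagram of a transversal sparse paving positroid (that is, the positroid associated with $D_{k,n}(A)$ is a sparse paving matroid and a transversal matroid) if and only if $|A|\le k$.
   Context: $[n]=\{1,\dots,n\}$. A set $A\subseteq[n]$ is non-adjacent if for every $i\in A$ we have $i-1\notin A$ and $i+1\notin A$, working modulo $n$ with representatives $[n]$. **Diagrams.** Young diagrams are left-justified with the largest part on top; box $(i,j)$ is in row $i$ (increasing downward) and column $j$ (increasing to the right). A $\mathsf{Le}$-diagram is a filling of a Young diagram in which each box is either empty or contains $\bullet$, such that for $i<i'$ and $j<j'$: if box $(i',j')$ exists and boxes $(i,j')$ and $(i',j)$ both contain $\bullet$, then $(i',j')$ contains $\bullet$. We consider $\mathsf{Le}$-diagrams fitting inside a $k\times(n-k)$ box. **The diagrams $D_{k,n}(A)$.** $D_{k,n}$ is the $k\times(n-k)$ rectangle with every box containing $\bullet$. Label $n$ of the boxes along its boundary as follows: the box in the lower right corner is labeled $1$; the boxes of the top row are labeled, from right to left, $2,3,\dots,n-k+1$; the boxes of the leftmost column are labeled, from top to bottom, $n-k+1,n-k+2,\dots,n$. For $A\subseteq[n]$, $D_{k,n}(A)$ is obtained from $D_{k,n}$ by removing the $\bullet$ in the box labeled $i$ for each $i\in A$; when $1\in A$, the box labeled $1$ is itself also removed from the Young diagram. Each $D_{k,n}(A)$ is a $\mathsf{Le}$-diagram. **Positroid associated with a $\mathsf{Le}$-diagram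 $D$.** The southeast border of $D$ inside the $k\times(n-k)$ box (together, where needed, with parts of the top and left sides of the box) is a lattice path from the top right corner to the bottom left corner of the box. Place a boundary vertex on each of its $n$ steps, labeled $1,\dots,n$ in order starting from the top right. Vertical steps are sources (one for each row), horizontal steps are sinks (one for each column). Each $\bullet$ is an internal vertex. From each source or internal vertex, a directed edge is drawn leftward to the nearest internal vertex to the left in the same row, if there is one; it carries a positive real weight. From each internal vertex a directed edge of weight $1$ is drawn downward to the nearest internal vertex below it in the same column, or to the sink of that column if there is none. Call this network $N_D$. With $K$ the set of sources, $\operatorname{Meas}(N_D)$ is the $K\times[n]$ matrix with entries $\operatorname{Meas}(N_D)_{ij}=\sum_{P:i\rightsquigarrow j}(-1)^{s_{ij}}\prod_{e\in P}w_e$, the sum being over directed paths from $i$ to $j$ (the empty path gives $\operatorname{Meas}(N_D)_{ii}=1$), where $w_e$ is the weight of $e$ and $s_{ij}$ is the number of sources strictly between $i$ and $j$. The positroid associated with $D$ is the matroid on $[n]$ whose bases are the $k$-subsets indexing nonvanishing maximal minors of $\operatorname{Meas}(N_D)$; it does not depend on the choice of positive weights. **Matroid notions.** A rank $k$ matroid on $E$ is sparse paving if every $k$-element subset of $E$ is either a basis or a circuit-hyperplane (both a circuit and a hyperplane). A rank $k$ matroid is transversal if there is a family $(S_1,\dots,S_k)$ of subsets of $E$ (repetitions allowed) whose transversals, i.e. the sets $I\subseteq E$ for which there is a bijection $\phi:[k]\to I$ with $\phi(j)\in S_j$ for all $j$, are exactly the bases. *)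

theory Defs
  imports
    Complex_Main
    "Graph_Theory.Pair_Digraph"
    "Jordan_Normal_Form.Determinant"
begin

section \<open>Matroids, given by ground set and set of bases\<close>

definition matroid :: "'a set \<Rightarrow> 'a set set \<Rightarrow> bool" where
  "matroid E \<B> \<longleftrightarrow> finite E \<and> \<B> \<noteq> {} \<and> (\<forall>X\<in>\<B>. X \<subseteq> E) \<and>
     (\<forall>X\<in>\<B>. \<forall>Y\<in>\<B>. \<forall>x\<in>X - Y. \<exists>y\<in>Y - X. insert y (X - {x}) \<in> \<B>)"

definition indep :: "'a set set \<Rightarrow> 'a set \<Rightarrow> bool" where
  "indep \<B> I \<longleftrightarrow> (\<exists>X\<in>\<B>. I \<subseteq> X)"

definition rank_of :: "'a set set \<Rightarrow> 'a set \<Rightarrow> nat" where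
  "rank_of \<B> X = Max (card ` {I. I \<subseteq> X \<and> indep \<B> I})"

definition circuit :: "'a set \<Rightarrow> 'a set set \<Rightarrow> 'a set \<Rightarrow> bool" where
  "circuit E \<B> C \<longleftrightarrow> C \<subseteq> E \<and> \<not> indep \<B> C \<and> (\<forall>C'. C' \<subset> C \<longrightarrow> indep \<B> C')"

definition flat :: "'a set \<Rightarrow> 'a set set \<Rightarrow> 'a set \<Rightarrow> bool" where
  "flat E \<B> F \<longleftrightarrow> F \<subseteq> E \<and> (\<forall>x\<in>E - F. rank_of \<B> F < rank_of \<B> (insert x F))"

definition hyperplane :: "'a set \<Rightarrow> 'a set set \<Rightarrow> 'a set \<Rightarrow> bool" where
  "hyperplane E \<B> H \<longleftrightarrow> flat E \<B> H \<and> Suc (rank_of \<B> H) = rank_of \<B> E"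

definition sparse_paving :: "'a set \<Rightarrow> 'a set set \<Rightarrow> bool" where
  "sparse_paving E \<B> \<longleftrightarrow> matroid E \<B> \<and>
     (\<forall>X. X \<subseteq> E \<and> card X = rank_of \<B> E \<longrightarrow>
        X \<in> \<B> \<or> (circuit E \<B> X \<and> hyperplane E \<B> X))"

definition transversals :: "nat \<Rightarrow> (nat \<Rightarrow> 'a set) \<Rightarrow> 'a set set" where
  "transversals r S = {I. \<exists>\<phi>. bij_betw \<phi> {1..r} I \<and> (\<forall>j\<in>{1..r}. \<phi> j \<in> S j)}"

definition transversal_matroid :: "'a set \<Rightarrow> 'a set set \<Rightarrow> bool" where
  "transversal_matroid E \<B> \<longleftrightarrow> matroid E \<B> \<and>
     (\<exists>S. (\<forall>j\<in>{1..rank_of \<B> E}. S j \<subseteq> E) \<and> \<B> = transversals (rank_of \<B> E) S)"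

section \<open>Diagrams\<close>

text \<open>A box (i, j) lies in row i (downward) and column j (to the right), both counted from 1.\<close>

record diagram =
  boxes :: "(nat \<times> nat) set"
  dots :: "(nat \<times> nat) set"

definition le_diagram :: "nat \<Rightarrow> nat \<Rightarrow> diagram \<Rightarrow> bool" where
  "le_diagram k n D \<longleftrightarrow>
     boxes D \<subseteq> {1..k} \<times> {1..n - k} \<and>
     (\<forall>i j i' j'. (i', j') \<in> boxes D \<and> 1 \<le> i \<and> i \<le> i' \<and> 1 \<le> j \<and> j \<le> j' \<longrightarrow> (i, j) \<in> boxes D) \<and>
     dots D \<subseteq> boxes D \<and>
     (\<forall>i j i' j'. i < i' \<and> j < j' \<and> (i', j') \<in> boxes D \<and> (i, j') \<in> dots D \<and> (i', j) \<in> dots D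
        \<longrightarrow> (i', j') \<in> dots D)"

definition labeled_box :: "nat \<Rightarrow> nat \<Rightarrow> nat \<Rightarrow> nat \<times> nat" where
  "labeled_box k n l =
     (if l = 1 then (k, n - k)
      else if l \<le> n - k + 1 then (1, n - k + 2 - l)
      else (l - (n - k), 1))"

definition diagram_of :: "nat \<Rightarrow> nat \<Rightarrow> nat set \<Rightarrow> diagram" where
  "diagram_of k n A =
     \<lparr> boxes = {1..k} \<times> {1..n - k} - (if 1 \<in> A then {labeled_box k n 1} else {}),
       dots = {1..k} \<times> {1..n - k} - labeled_box k n ` A \<rparr>"

definition nonadjacent :: "nat \<Rightarrow> nat set \<Rightarrow> bool" where
  "nonadjacent n A \<longleftrightarrow>
     (\<forall>i\<in>A. (if i = 1 then n else i - 1) \<notin> A \<and> (if i = n then 1 else i + 1) \<notin> A)"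

section \<open>The network of a diagram\<close>

text \<open>
  The southeast border. The lattice point (r, c) has r rows above it and c columns to its left;
  the path starts at the top right corner (0, n - k) and after n steps reaches (k, 0). Box (r + 1, c)
  is the one southwest of the point (r, c): the path may go left exactly when this box is absent.
\<close>

primrec border :: "nat \<Rightarrow> nat \<Rightarrow> diagram \<Rightarrow> nat \<Rightarrow> nat \<times> nat" where
  "border k n D 0 = (0, n - k)"
| "border k n D (Suc t) =
     (let (r, c) = border k n D t in
      if 0 < c \<and> (Suc r, c) \<notin> boxes D then (r, c - 1) else (Suc r, c))"

definition source_of_row :: "nat \<Rightarrow> nat \<Rightarrow> diagram \<Rightarrow> nat \<Rightarrow> nat \<Rightarrow> bool" where
  "source_of_row k n D t i \<longleftrightarrow> t \<in> {1..n} \<and>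
     (\<exists>c. border k n D (t - 1) = (i - 1, c) \<and> border k n D t = (i, c) \<and> 1 \<le> i)"

definition sink_of_column :: "nat \<Rightarrow> nat \<Rightarrow> diagram \<Rightarrow> nat \<Rightarrow> nat \<Rightarrow> bool" where
  "sink_of_column k n D t j \<longleftrightarrow> t \<in> {1..n} \<and>
     (\<exists>r. border k n D (t - 1) = (r, j) \<and> border k n D t = (r, j - 1) \<and> 1 \<le> j)"

definition sources :: "nat \<Rightarrow> nat \<Rightarrow> diagram \<Rightarrow> nat set" where
  "sources k n D = {t. \<exists>i. source_of_row k n D t i}"

datatype vertex = Boundary nat | Internal nat nat

definition rightmost_dot :: "diagram \<Rightarrow> nat \<Rightarrow> nat \<Rightarrow> bool" where
  "rightmost_dot D i j \<longleftrightarrow> (i, j) \<in> dots D \<and> (\<forall>j'. (i, j') \<in> dots D \<longrightarrow> j' \<le> j)"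

definition nearest_dot_left :: "diagram \<Rightarrow> nat \<Rightarrow> nat \<Rightarrow> nat \<Rightarrow> bool" where
  "nearest_dot_left D i c j \<longleftrightarrow>
     (i, j) \<in> dots D \<and> j < c \<and> (\<forall>j'. (i, j') \<in> dots D \<and> j' < c \<longrightarrow> j' \<le> j)"

definition nearest_dot_below :: "diagram \<Rightarrow> nat \<Rightarrow> nat \<Rightarrow> nat \<Rightarrow> bool" where
  "nearest_dot_below D r j i \<longleftrightarrow>
     (i, j) \<in> dots D \<and> r < i \<and> (\<forall>i'. (i', j) \<in> dots D \<and> r < i' \<longrightarrow> i \<le> i')"

text \<open>
  All dots of a row lie to the left of the source of that row, so its nearest dot is the
  rightmost one.
\<close>

definition left_edges :: "nat \<Rightarrow> nat \<Rightarrow> diagram \<Rightarrow> (vertex \<times> vertex) set" where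
  "left_edges k n D =
     {(Boundary t, Internal i j) | t i j. source_of_row k n D t i \<and> rightmost_dot D i j} \<union>
     {(Internal i c, Internal i j) | i c j. (i, c) \<in> dots D \<and> nearest_dot_left D i c j}"

definition down_edges :: "nat \<Rightarrow> nat \<Rightarrow> diagram \<Rightarrow> (vertex \<times> vertex) set" where
  "down_edges k n D =
     {(Internal r j, Internal i j) | r j i. (r, j) \<in> dots D \<and> nearest_dot_below D r j i} \<union>
     {(Internal r j, Boundary t) | r j t. (r, j) \<in> dots D \<and>
        (\<forall>i. r < i \<longrightarrow> (i, j) \<notin> dots D) \<and> sink_of_column k n D t j}"

definition network :: "nat \<Rightarrow> nat \<Rightarrow> diagram \<Rightarrow> vertex pair_pre_digraph" where
  "network k n D =
     \<lparr> pverts = Boundary ` {1..n} \<union> {Internal i j | i j. (i, j) \<in> dots D},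
       parcs = left_edges k n D \<union> down_edges k n D \<rparr>"

text \<open>Only the values of w on the left edges matter; these are required to be positive.\<close>

definition edge_weight ::
    "nat \<Rightarrow> nat \<Rightarrow> diagram \<Rightarrow> (vertex \<times> vertex \<Rightarrow> real) \<Rightarrow> vertex \<times> vertex \<Rightarrow> real" where
  "edge_weight k n D w e = (if e \<in> down_edges k n D then 1 else w e)"

definition positive_weights ::
    "nat \<Rightarrow> nat \<Rightarrow> diagram \<Rightarrow> (vertex \<times> vertex \<Rightarrow> real) \<Rightarrow> bool" where
  "positive_weights k n D w \<longleftrightarrow> (\<forall>e\<in>left_edges k n D. 0 < w e)"

section \<open>The positroid of a diagram\<close>

definition meas ::
    "nat \<Rightarrow> nat \<Rightarrow> diagram \<Rightarrow> (vertex \<times> vertex \<Rightarrow> real) \<Rightarrow> nat \<Rightarrow> nat \<Rightarrow> real" where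
  "meas k n D w i j =
     (\<Sum>p | pre_digraph.apath (with_proj (network k n D)) (Boundary i) p (Boundary j).
        (-1) ^ card {s \<in> sources k n D. min i j < s \<and> s < max i j} *
        prod_list (map (edge_weight k n D w) p))"

definition maximal_minor ::
    "nat \<Rightarrow> nat \<Rightarrow> diagram \<Rightarrow> (vertex \<times> vertex \<Rightarrow> real) \<Rightarrow> nat set \<Rightarrow> real" where
  "maximal_minor k n D w J =
     det (mat k k (\<lambda>(a, b).
       meas k n D w (sorted_list_of_set (sources k n D) ! a) (sorted_list_of_set J ! b)))"

definition positroid_bases ::
    "nat \<Rightarrow> nat \<Rightarrow> diagram \<Rightarrow> (vertex \<times> vertex \<Rightarrow> real) \<Rightarrow> nat set set" where
  "positroid_bases k n D w =
     {J. J \<subseteq> {1..n} \<and> card J = k \<and> maximal_minor k n D w J \<noteq> 0}"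

end

theory Submission
  imports Defs
begin

text \<open>
  The bases of the positroid of \<open>D\<^sub>k\<^sub>,\<^sub>n(A)\<close> are the \<open>k\<close>-subsets of \<open>[n]\<close> other than the cyclic
  intervals \<open>{l, \<dots>, l + k - 1}\<close> with \<open>l \<in> A\<close>. Non-adjacency makes two of these intervals meet in at
  most \<open>k - 2\<close> points, so the matroid is always sparse paving. By Hall's theorem every
  circuit-hyperplane of a transversal sparse paving matroid misses some member of the presentation,
  and two of them cannot miss the same one, whence \<open>|A| \<le> k\<close>; conversely the complements of the
  intervals form a presentation, because \<open>t \<ge> 2\<close> of them meet in at most \<open>k - t\<close> points.

  A \<open>k\<close>-set \<open>J\<close> fails to be a basis iff some nonzero vector supported on \<open>J\<close> lies in the kernel of
  the measurement matrix. Let \<open>u i j\<close> be the potential induced by such a vector on the wire of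
  column \<open>j\<close> where it enters row \<open>i\<close>. Passing from row \<open>i\<close> to row \<open>i + 1\<close> replaces \<open>u i\<close> by weighted
  differences of neighbouring entries, so by a discrete Rolle theorem each row adds a sign change
  to the kernel vector. A vector with \<open>k\<close> sign changes has more than \<open>k\<close> nonzero entries; a missing
  dot loses sign changes only for the vectors supported on the corresponding cyclic interval.
\<close>

section \<open>Hall's theorem\<close>

text \<open>For a full rectangle the kernel argument is the classical one for totally positive
  matrices: \<open>k\<close> rows force \<open>k\<close> sign changes, so no nonzero kernel vector
  fits into \<open>k\<close> coordinates. The obstacle is a missing dot: the wire in its column
  passes the row untouched, and if it is the only wire with nonzero potential, the row adds no sign
  change. Such a lone wire starts a cone that widens by one column per row on its way down, and the
  coordinates reached by the cone lie in the cyclic interval that starts at the label of the dot;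
  this is where the intervals come from. Non-adjacency ensures that one vector cannot lose in this
  way twice: for instance, the row after a missing dot of the first column has its first dot, which
  wakes the second wire for good. The top row needs its own treatment, since many of its dots may be
  missing and its left edges then jump over columns. It enters only as a linear form with
  nonnegative coefficients, zero exactly at the missing dots; if several wires below missing dots
  are alive, row 2 makes up for the loss by two sign changes at once.\<close>

lemma hall:
  assumes "finite T" and "\<And>j. j \<in> T \<Longrightarrow> finite (S j)"
    and "\<And>K. K \<subseteq> T \<Longrightarrow> card K \<le> card (\<Union>j\<in>K. S j)"
  shows "\<exists>\<phi>. inj_on \<phi> T \<and> (\<forall>j\<in>T. \<phi> j \<in> S j)"
  using assms
proof (induction "card T" arbitrary: T S rule: less_induct)
  case less
  note finT = less.prems(1) and finS = less.prems(2) and hall = less.prems(3)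
  show ?case
  proof (cases "T = {}")
    case True
    then show ?thesis by simp
  next
    case ne: False
    \<comment> \<open>Halmos-Vaughan induction: if a proper subfamily is tight, it and the rest are
      matched separately; otherwise every proper subfamily has an element to spare, so one choice
      can be fixed in advance.\<close>
    show ?thesis
    proof (cases "\<exists>K. K \<subset> T \<and> K \<noteq> {} \<and> card (\<Union>j\<in>K. S j) \<le> card K")
      case True
      then obtain K where K: "K \<subset> T" "K \<noteq> {}" and tight: "card (\<Union>j\<in>K. S j) \<le> card K" by blast
      let ?U = "\<Union>j\<in>K. S j"
      have finK: "finite K" using K finT finite_subset by blast
      have finU: "finite ?U" using finK finS K by blast
      have "card K < card T" using K finT psubset_card_mono by blast
      moreover note finK
      moreover have "finite (S j)" if "j \<in> K" for j using finS K that by blast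
      moreover have "card L \<le> card (\<Union>j\<in>L. S j)" if "L \<subseteq> K" for L using hall that K by blast
      ultimately have "\<exists>\<phi>. inj_on \<phi> K \<and> (\<forall>j\<in>K. \<phi> j \<in> S j)" by (rule less.hyps)
      then obtain \<phi>1 where 1: "inj_on \<phi>1 K" "\<And>j. j \<in> K \<Longrightarrow> \<phi>1 j \<in> S j" by blast
      have "card (T - K) < card T"
        using K finT by (intro psubset_card_mono) auto
      moreover have "finite (T - K)" using finT by blast
      moreover have "finite (S j - ?U)" if "j \<in> T - K" for j using finS that by blast
      \<comment> \<open>Hall's condition is applied to \<open>L \<union> K\<close>, and
        \<open>?U\<close> is discounted, which has at most \<open>card K\<close> elements.\<close>
      moreover have "card L \<le> card (\<Union>j\<in>L. S j - ?U)" if L: "L \<subseteq> T - K" for L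
      proof -
        have finL: "finite L" using L finT finite_subset by blast
        have "card L + card K = card (L \<union> K)"
          using L finL finK by (subst card_Un_disjoint) auto
        also have "\<dots> \<le> card (\<Union>j\<in>L \<union> K. S j)" using L K by (intro hall) blast
        also have "(\<Union>j\<in>L \<union> K. S j) = (\<Union>j\<in>L. S j - ?U) \<union> ?U" by blast
        also have "card \<dots> \<le> card (\<Union>j\<in>L. S j - ?U) + card ?U" by (rule card_Un_le)
        finally show ?thesis using tight by linarith
      qed
      ultimately have "\<exists>\<phi>. inj_on \<phi> (T - K) \<and> (\<forall>j\<in>T - K. \<phi> j \<in> S j - ?U)"
        by (rule less.hyps)
      then obtain \<phi>2 where 2: "inj_on \<phi>2 (T - K)" "\<forall>j\<in>T - K. \<phi>2 j \<in> S j - ?U"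
        by (elim exE conjE)
      let ?\<phi> = "\<lambda>j. if j \<in> K then \<phi>1 j else \<phi>2 j"
      have "inj_on ?\<phi> T"
      proof (rule inj_onI)
        fix i j assume ij: "i \<in> T" "j \<in> T" and eq: "?\<phi> i = ?\<phi> j"
        have sep: "\<phi>1 a \<noteq> \<phi>2 b" if "a \<in> K" "b \<in> T - K" for a b
        proof -
          have "\<phi>1 a \<in> ?U" using 1(2)[OF that(1)] that(1) by blast
          moreover have "\<phi>2 b \<notin> ?U" using bspec[OF 2(2) that(2)] by simp
          ultimately show ?thesis by metis
        qed
        show "i = j"
        proof (cases "i \<in> K")
          case True
          then show ?thesis using eq ij sep[of i j] inj_onD[OF 1(1)] by (cases "j \<in> K") auto
        next
          case False
          then show ?thesis using eq ij sep[of j i] inj_onD[OF 2(1)] by (cases "j \<in> K") auto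
        qed
      qed
      moreover have "\<forall>j\<in>T. ?\<phi> j \<in> S j" using 1 2 by auto
      ultimately show ?thesis by blast
    next
      case slack: False
      obtain t where t: "t \<in> T" using ne by blast
      have "card {t} \<le> card (\<Union>j\<in>{t}. S j)" using t by (intro hall) blast
      then have "S t \<noteq> {}" by auto
      then obtain x where x: "x \<in> S t" by blast
      have "card (T - {t}) < card T" using t finT by (intro psubset_card_mono) auto
      moreover have "finite (T - {t})" using finT by blast
      moreover have "finite (S j - {x})" if "j \<in> T - {t}" for j using finS that by blast
      moreover have "card K \<le> card (\<Union>j\<in>K. S j - {x})" if K: "K \<subseteq> T - {t}" for K
      proof (cases "K = {}")
        case False
        moreover have "K \<subset> T" using K t by blast
        ultimately have "card K < card (\<Union>j\<in>K. S j)" using slack not_less by blast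
        moreover have eq: "(\<Union>j\<in>K. S j - {x}) = (\<Union>j\<in>K. S j) - {x}" by blast
        moreover have "card (\<Union>j\<in>K. S j) - 1 \<le> card ((\<Union>j\<in>K. S j) - {x})"
          by (simp add: card_Diff_singleton_if)
        ultimately show ?thesis unfolding eq by linarith
      qed simp
      ultimately have "\<exists>\<phi>. inj_on \<phi> (T - {t}) \<and> (\<forall>j\<in>T - {t}. \<phi> j \<in> S j - {x})"
        by (rule less.hyps)
      then obtain \<phi> where \<phi>: "inj_on \<phi> (T - {t})" "\<And>j. j \<in> T - {t} \<Longrightarrow> \<phi> j \<in> S j - {x}"
        by blast
      have "inj_on (\<phi>(t := x)) T"
      proof (rule inj_onI)
        fix i j assume "i \<in> T" "j \<in> T" "(\<phi>(t := x)) i = (\<phi>(t := x)) j"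
        then show "i = j" using \<phi>(2)[of i] \<phi>(2)[of j] inj_onD[OF \<phi>(1), of i j]
          by (auto split: if_splits)
      qed
      moreover have "\<forall>j\<in>T. (\<phi>(t := x)) j \<in> S j" using \<phi>(2) x by auto
      ultimately show ?thesis by blast
    qed
  qed
qed

section \<open>Sparse paving matroids from families of almost disjoint sets\<close>

lemma rank_of_eqI:
  assumes "finite X" and "\<And>I. I \<subseteq> X \<Longrightarrow> indep \<B> I \<Longrightarrow> card I \<le> r"
    and "I \<subseteq> X" "indep \<B> I" "card I = r"
  shows "rank_of \<B> X = r"
  unfolding rank_of_def
proof (rule Max_eqI)
  show "finite (card ` {I. I \<subseteq> X \<and> indep \<B> I})" using assms(1) by auto
qed (use assms in auto)

text \<open>\<open>F\<close> collects the prospective circuit-hyperplanes. By the last assumption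
  two of them share at most \<open>k - 2\<close> points, so they are non-adjacent vertices of the
  Johnson graph.\<close>

locale sparse_family =
  fixes E :: "'a set" and k :: nat and F :: "'a set set"
  assumes finite_E: "finite E" and k: "1 \<le> k" and k_less: "k < card E"
    and F_subset: "\<And>H. H \<in> F \<Longrightarrow> H \<subseteq> E" and F_card: "\<And>H. H \<in> F \<Longrightarrow> card H = k"
    and F_inter: "\<And>H H'. H \<in> F \<Longrightarrow> H' \<in> F \<Longrightarrow> H \<noteq> H' \<Longrightarrow> Suc (card (H \<inter> H')) < k"
begin

definition bases :: "'a set set" where
  "bases = {J. J \<subseteq> E \<and> card J = k \<and> J \<notin> F}"

lemma finite_subset_E: "X \<subseteq> E \<Longrightarrow> finite X"
  using finite_E finite_subset by blast

lemma card_swap: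
  assumes "X \<subseteq> E" "card X = k" "x \<in> X" "y \<notin> X"
  shows "card (insert y (X - {x})) = k"
  using assms finite_subset_E[OF assms(1)] k by simp

text \<open>An exchange leaves \<open>k - 1\<close> points in common with \<open>H\<close>, more
  than two members of \<open>F\<close> may share.\<close>

lemma swap_basis:
  assumes H: "H \<in> F" and x: "x \<in> H" and y: "y \<in> E - H"
  shows "insert y (H - {x}) \<in> bases"
proof -
  let ?X = "insert y (H - {x})"
  have fin: "finite H" using finite_subset_E F_subset[OF H] .
  have "H \<inter> ?X = H - {x}" using y by blast
  then have "Suc (card (H \<inter> ?X)) = k" using fin x F_card[OF H] k by simp
  moreover have "?X \<noteq> H" using y by blast
  ultimately have "?X \<notin> F" using F_inter[OF H, of ?X] by force
  then show ?thesis using card_swap[of H x y] F_subset[OF H] F_card[OF H] x y by (auto simp: bases_def)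
qed

lemma outside: "X \<subseteq> E \<Longrightarrow> card X = k \<Longrightarrow> \<exists>y. y \<in> E - X"
  using k_less by (cases "X = E") auto

lemma nonempty: "bases \<noteq> {}"
proof (cases "F = {}")
  case True
  obtain X where "X \<subseteq> E" "card X = k" using obtain_subset_with_card_n[of k E] k_less by auto
  then have "X \<in> bases" unfolding bases_def using True by simp
  then show ?thesis by blast
next
  case False
  then obtain H where H: "H \<in> F" by blast
  obtain y where "y \<in> E - H" using outside F_subset[OF H] F_card[OF H] by blast
  moreover obtain x where "x \<in> H" using F_card[OF H] k by fastforce
  ultimately show ?thesis using swap_basis[OF H] by blast
qed

lemma basisD: "X \<in> bases \<Longrightarrow> X \<subseteq> E \<and> card X = k \<and> finite X"
  using finite_subset_E by (auto simp: bases_def)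

lemma matroid: "matroid E bases"
  unfolding matroid_def
proof (intro conjI ballI)
  fix X Y x assume X: "X \<in> bases" and Y: "Y \<in> bases" and x: "x \<in> X - Y"
  have "card (X - Y) = card (Y - X)"
    using basisD[OF X] basisD[OF Y] by (simp add: card_Diff_subset_Int Int_commute)
  moreover have "finite (X - Y)" "finite (Y - X)" using basisD[OF X] basisD[OF Y] by auto
  moreover have "card (X - Y) > 0" using x \<open>finite (X - Y)\<close> card_gt_0_iff by blast
  ultimately have "Y - X \<noteq> {}" by (metis card.empty less_irrefl)
  then obtain y where y: "y \<in> Y - X" by blast
  have in_F: "insert z (X - {x}) \<in> F" if "z \<in> Y - X" "insert z (X - {x}) \<notin> bases" for z
    using that card_swap[of X x z] basisD[OF X] basisD[OF Y] x by (auto simp: bases_def)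
  show "\<exists>y\<in>Y - X. insert y (X - {x}) \<in> bases"
  proof (cases "Y - X = {y}")
    case True
    then have "card (X - Y) = 1" using \<open>card (X - Y) = card (Y - X)\<close> by simp
    then have "X - Y = {x}" using x by (metis card_1_singletonE singletonD)
    then have "insert y (X - {x}) = Y" using True x by blast
    then show ?thesis using Y y by auto
  next
    case False
    then obtain y' where y': "y' \<in> Y - X" "y' \<noteq> y" using y by blast
    \<comment> \<open>If both exchanges failed, two members of \<open>F\<close> would share the
      \<open>k - 1\<close> points of \<open>X - {x}\<close>.\<close>
    show ?thesis
    proof (rule ccontr)
      assume "\<not> ?thesis"
      then have F2: "insert y (X - {x}) \<in> F" "insert y' (X - {x}) \<in> F" using in_F y y' by blast+
      have "insert y (X - {x}) \<noteq> insert y' (X - {x})" using y y' by blast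
      from F_inter[OF F2 this]
      have "Suc (card (insert y (X - {x}) \<inter> insert y' (X - {x}))) < k" .
      moreover have "insert y (X - {x}) \<inter> insert y' (X - {x}) = X - {x}" using y y' by blast
      ultimately show False using basisD[OF X] x by simp
    qed
  qed
qed (use finite_E nonempty in \<open>auto simp: bases_def\<close>)

lemma indep_card: "indep bases I \<Longrightarrow> card I \<le> k"
  using basisD by (auto simp: indep_def intro: card_mono)

lemma rank_E: "rank_of bases E = k"
proof -
  obtain X where "X \<in> bases" using nonempty by blast
  then show ?thesis using basisD[of X] finite_E indep_card
    by (intro rank_of_eqI[of _ _ _ X]) (auto simp: indep_def)
qed

lemma F_dependent: "H \<in> F \<Longrightarrow> I \<subseteq> H \<Longrightarrow> indep bases I \<Longrightarrow> card I < k"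
proof (rule ccontr)
  assume H: "H \<in> F" and I: "I \<subseteq> H" "indep bases I" and "\<not> card I < k"
  then have "card I = k" using indep_card[of I] by simp
  moreover obtain X where X: "X \<in> bases" "I \<subseteq> X" using I by (auto simp: indep_def)
  moreover have "finite H" using finite_subset_E F_subset[OF H] .
  ultimately have "I = X" "I = H"
    using I F_card[OF H] basisD[OF X(1)] card_subset_eq[of X I] card_subset_eq[of H I] by simp_all
  then show False using X H by (simp add: bases_def)
qed

lemma circuit_hyperplane:
  assumes H: "H \<in> F"
  shows "circuit E bases H" and "hyperplane E bases H"
proof -
  have HE: "H \<subseteq> E" and cH: "card H = k" and fin: "finite H"
    using F_subset[OF H] F_card[OF H] finite_subset_E by auto
  obtain y where y: "y \<in> E - H" using outside HE cH by blast
  have ind: "indep bases (H - {x})" if "x \<in> H" for x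
    using swap_basis[OF H that y] by (auto simp: indep_def)
  show "circuit E bases H"
    unfolding circuit_def
  proof (intro conjI allI impI)
    show "\<not> indep bases H" using F_dependent[OF H subset_refl] cH by blast
    fix C' assume "C' \<subset> H"
    then obtain x where "x \<in> H" "C' \<subseteq> H - {x}" by blast
    then show "indep bases C'" using ind[of x] by (auto simp: indep_def)
  qed (rule HE)
  obtain x where x: "x \<in> H" using cH k by fastforce
  have rank_H: "rank_of bases H = k - 1"
  proof (rule rank_of_eqI[OF fin _ _ ind[OF x]])
    show "card I \<le> k - 1" if "I \<subseteq> H" "indep bases I" for I using F_dependent[OF H that] by simp
  qed (use x cH fin in auto)
  have "rank_of bases (insert z H) = k" if z: "z \<in> E - H" for z
  proof (rule rank_of_eqI)
    show "finite (insert z H)" using fin by simp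
    show "indep bases (insert z (H - {x}))" using swap_basis[OF H x z] by (auto simp: indep_def)
    show "card (insert z (H - {x})) = k" using basisD swap_basis[OF H x z] by blast
  qed (use indep_card in auto)
  then show "hyperplane E bases H"
    using rank_H rank_E HE k by (auto simp: hyperplane_def flat_def)
qed

lemma sparse_paving: "sparse_paving E bases"
  unfolding sparse_paving_def rank_E using matroid circuit_hyperplane by (auto simp: bases_def)

section \<open>Transversal presentations\<close>

lemma transversal_imp_card_le:
  assumes "transversal_matroid E bases"
  shows "card F \<le> k"
proof -
  obtain S where S: "\<And>j. j \<in> {1..k} \<Longrightarrow> S j \<subseteq> E" and B: "bases = transversals k S"
    using assms unfolding transversal_matroid_def rank_E by blast
  have basis: "\<exists>\<phi>. bij_betw \<phi> {1..k} X \<and> (\<forall>j\<in>{1..k}. \<phi> j \<in> S j)" if "X \<in> bases" for X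
    using that unfolding B transversals_def by blast
  \<comment> \<open>\<open>H\<close> is no transversal, so Hall's condition fails for the traces
    \<open>H \<inter> S j\<close> on some \<open>K\<close>. The violation turns out to be total: no
    member indexed by \<open>K\<close> meets \<open>H\<close>.\<close>
  have disj: "\<exists>j\<in>{1..k}. H \<inter> S j = {}" if H: "H \<in> F" for H
  proof -
    have fin: "finite H" using finite_subset_E F_subset[OF H] .
    have "\<exists>K\<subseteq>{1..k}. card (\<Union>j\<in>K. H \<inter> S j) < card K"
    proof (rule ccontr)
      assume "\<not> ?thesis"
      then have "\<exists>\<phi>. inj_on \<phi> {1..k} \<and> (\<forall>j\<in>{1..k}. \<phi> j \<in> H \<inter> S j)"
        using fin by (intro hall) (auto simp: not_less)
      then obtain \<phi> where \<phi>: "inj_on \<phi> {1..k}" "\<And>j. j \<in> {1..k} \<Longrightarrow> \<phi> j \<in> H \<inter> S j" by blast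
      have "\<phi> ` {1..k} = H"
        using \<phi> fin F_card[OF H] card_image[OF \<phi>(1)] by (intro card_subset_eq) auto
      then have "H \<in> transversals k S"
        using \<phi> unfolding transversals_def bij_betw_def by blast
      then show False using H unfolding B[symmetric] by (simp add: bases_def)
    qed
    then obtain K where K: "K \<subseteq> {1..k}" and lt: "card (\<Union>j\<in>K. H \<inter> S j) < card K" by blast
    let ?V = "\<Union>j\<in>K. S j"
    have HV: "(\<Union>j\<in>K. H \<inter> S j) = H \<inter> ?V" by blast
    have "H \<inter> ?V = {}"
    proof (rule ccontr)
      assume "H \<inter> ?V \<noteq> {}"
      \<comment> \<open>Exchanging \<open>x\<close> for \<open>y\<close> removes a point of
        \<open>?V\<close>, so the resulting basis offers the members indexed by \<open>K\<close> at
        most \<open>card (H \<inter> ?V)\<close> points, which is too few.\<close>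
      then obtain x where x: "x \<in> H" "x \<in> ?V" by blast
      obtain y where y: "y \<in> E - H" using outside F_subset[OF H] F_card[OF H] by blast
      obtain \<phi> where \<phi>: "bij_betw \<phi> {1..k} (insert y (H - {x}))" "\<forall>j\<in>{1..k}. \<phi> j \<in> S j"
        using basis[OF swap_basis[OF H x(1) y]] by blast
      have "card K = card (\<phi> ` K)"
        using \<phi>(1) K card_image inj_on_subset unfolding bij_betw_def by metis
      also have "\<dots> \<le> card (insert y (H \<inter> ?V - {x}))"
      proof (rule card_mono)
        show "\<phi> ` K \<subseteq> insert y (H \<inter> ?V - {x})"
        proof
          fix z assume "z \<in> \<phi> ` K"
          then obtain j where j: "j \<in> K" "z = \<phi> j" by blast
          then have "z \<in> insert y (H - {x})" using bij_betw_apply[OF \<phi>(1), of j] K by blast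
          moreover have "z \<in> ?V" using \<phi>(2) j K by blast
          ultimately show "z \<in> insert y (H \<inter> ?V - {x})" by blast
        qed
      qed (use fin in simp)
      also have "\<dots> \<le> Suc (card (H \<inter> ?V - {x}))" by (rule card_insert_le_m1) (auto simp: fin)
      also have "\<dots> = card (H \<inter> ?V)" using x fin by (intro card_Suc_Diff1) auto
      finally show False using lt HV by simp
    qed
    moreover have "K \<noteq> {}" using lt by auto
    ultimately show ?thesis using K by blast
  qed
  then obtain f where f: "\<And>H. H \<in> F \<Longrightarrow> f H \<in> {1..k} \<and> H \<inter> S (f H) = {}" by metis
  \<comment> \<open>If \<open>H\<close> and \<open>H'\<close> missed the same member, an exchange
    that brings a point of \<open>H'\<close> into \<open>H\<close> would give a basis that misses it
    as well.\<close>
  have "inj_on f F"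
  proof (rule inj_onI, rule ccontr)
    fix H H' assume H: "H \<in> F" "H' \<in> F" "f H = f H'" "H \<noteq> H'"
    have fin: "finite H" "finite H'" using finite_subset_E F_subset H by blast+
    have "\<not> H' \<subseteq> H" using card_subset_eq[OF fin(1), of H'] F_card H by auto
    then obtain y where y: "y \<in> H'" "y \<notin> H" by blast
    obtain x where x: "x \<in> H" using F_card[OF H(1)] k by fastforce
    have "y \<in> E - H" using y F_subset[OF H(2)] by blast
    then obtain \<phi> where \<phi>: "bij_betw \<phi> {1..k} (insert y (H - {x}))" "\<forall>j\<in>{1..k}. \<phi> j \<in> S j"
      using basis[OF swap_basis[OF H(1) x]] by blast
    have "\<phi> (f H) \<in> insert y (H - {x})" using \<phi>(1) f[OF H(1)] bij_betw_apply by metis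
    moreover have "\<phi> (f H) \<in> S (f H)" using \<phi>(2) f[OF H(1)] by blast
    ultimately show False using f[OF H(1)] f[OF H(2)] y H(3) by auto
  qed
  moreover have "f ` F \<subseteq> {1..k}" using f by blast
  ultimately show ?thesis using card_inj_on_le[of f F "{1..k}"] by simp
qed

text \<open>The presentation consists of the complements of the members of \<open>F\<close>, padded
  with copies of \<open>E\<close>. In Hall's condition for \<open>X\<close>, the complements indexed
  by \<open>K\<close> cover all of \<open>X\<close> except its part in the common intersection; for
  a single complement \<open>X \<notin> F\<close> suffices, for more the bound \<open>inter\<close>
  does.\<close>

lemma transversalI:
  assumes "finite F" and "card F \<le> k"
    and inter: "\<And>G. G \<subseteq> F \<Longrightarrow> 2 \<le> card G \<Longrightarrow> card (\<Inter>G) + card G \<le> k"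
  shows "transversal_matroid E bases"
proof -
  obtain f where f: "bij_betw f {1..card F} F" using ex_bij_betw_nat_finite_1[OF assms(1)] by blast
  define S where "S j = (if j \<le> card F then E - f j else E)" for j
  have "bases = transversals k S"
  proof (intro equalityI subsetI)
    fix X assume "X \<in> transversals k S"
    then obtain \<phi> where \<phi>: "bij_betw \<phi> {1..k} X" "\<And>j. j \<in> {1..k} \<Longrightarrow> \<phi> j \<in> S j"
      by (auto simp: transversals_def)
    have "X \<subseteq> E" using \<phi> by (force simp: bij_betw_def S_def split: if_splits)
    moreover have "card X = k" using bij_betw_same_card[OF \<phi>(1)] by simp
    moreover have "X \<notin> F"
    proof
      assume "X \<in> F"
      then have "X \<in> f ` {1..card F}" using f by (simp add: bij_betw_def)
      then obtain j where j: "j \<in> {1..card F}" "X = f j" by blast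
      then have "j \<in> {1..k}" using assms(2) by simp
      then have "\<phi> j \<in> X" "\<phi> j \<in> S j" using \<phi> by (auto simp: bij_betw_def)
      then show False using j by (simp add: S_def)
    qed
    ultimately show "X \<in> bases" by (simp add: bases_def)
  next
    fix X assume X: "X \<in> bases"
    then have XE: "X \<subseteq> E" and cX: "card X = k" and fin: "finite X" using basisD by auto
    have "\<exists>\<phi>. inj_on \<phi> {1..k} \<and> (\<forall>j\<in>{1..k}. \<phi> j \<in> X \<inter> S j)"
    proof (rule hall)
      fix K assume K: "K \<subseteq> {1..k}"
      have cK: "card K \<le> k" using card_mono[OF _ K] by simp
      show "card K \<le> card (\<Union>j\<in>K. X \<inter> S j)"
      proof (cases "K \<subseteq> {1..card F}")
        case False
        then obtain j where j: "j \<in> K" "j \<notin> {1..card F}" by blast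
        moreover have "j \<in> {1..k}" using j K by blast
        ultimately have "S j = E" by (simp add: S_def)
        then have "(\<Union>j\<in>K. X \<inter> S j) = X" using XE j by blast
        then show ?thesis using cK cX by simp
      next
        case True
        show ?thesis
        proof (cases "K = {}")
          case ne: False
          have sub: "f ` K \<subseteq> F" using f True by (auto simp: bij_betw_def)
          have cG: "card (f ` K) = card K"
            using f True card_image inj_on_subset unfolding bij_betw_def by metis
          have "(\<Union>j\<in>K. X \<inter> S j) = X - (X \<inter> \<Inter>(f ` K))" using True XE by (auto simp: S_def)
          then have card_eq: "card (\<Union>j\<in>K. X \<inter> S j) = k - card (X \<inter> \<Inter>(f ` K))"
            using fin cX by (simp add: card_Diff_subset)
          have "card (X \<inter> \<Inter>(f ` K)) + card K \<le> k"
          proof (cases "card K = 1")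
            case True
            then obtain j where j: "K = {j}" by (meson card_1_singletonE)
            have fj: "f j \<in> F" using sub j by simp
            then have finj: "finite (f j)" using finite_subset_E F_subset by blast
            have "X \<inter> f j \<noteq> X"
              using card_subset_eq[OF finj, of X] F_card[OF fj] cX X fj by (auto simp: bases_def)
            then have "card (X \<inter> f j) < k" using psubset_card_mono[OF fin, of "X \<inter> f j"] cX by blast
            then show ?thesis using j by simp
          next
            case False
            moreover have "finite K" using K finite_subset by blast
            ultimately have "2 \<le> card (f ` K)" using ne cG card_0_eq[of K] by linarith
            then have le: "card (\<Inter>(f ` K)) + card K \<le> k" using inter[OF sub] cG by simp
            obtain j where "j \<in> K" using ne by blast
            then have "finite (\<Inter>(f ` K))" using sub finite_subset_E F_subset
              by (meson Inf_lower finite_subset image_eqI subsetD)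
            then have "card (X \<inter> \<Inter>(f ` K)) \<le> card (\<Inter>(f ` K))" by (intro card_mono) auto
            then show ?thesis using le by linarith
          qed
          then show ?thesis using card_eq by linarith
        qed simp
      qed
    qed (use fin in auto)
    then obtain \<phi> where \<phi>: "inj_on \<phi> {1..k}" "\<And>j. j \<in> {1..k} \<Longrightarrow> \<phi> j \<in> X \<inter> S j" by blast
    have "\<phi> ` {1..k} = X"
      using \<phi> fin cX card_image[OF \<phi>(1)] by (intro card_subset_eq) auto
    then show "X \<in> transversals k S" using \<phi> unfolding transversals_def bij_betw_def by blast
  qed
  moreover have "\<forall>j\<in>{1..k}. S j \<subseteq> E" by (auto simp: S_def)
  ultimately show ?thesis unfolding transversal_matroid_def rank_E using matroid by blast
qed

end

section \<open>Cyclic intervals\<close>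

text \<open>The last disjunct is the part that wraps past \<open>n\<close>, written additively to
  avoid truncated subtraction.\<close>

definition cyclic_interval :: "nat \<Rightarrow> nat \<Rightarrow> nat \<Rightarrow> nat set" where
  "cyclic_interval k n l = {t \<in> {1..n}. l \<le> t \<and> t < l + k \<or> t + n < l + k}"

lemma card_cyclic_interval:
  assumes "1 \<le> l" "l \<le> n" "k \<le> n"
  shows "card (cyclic_interval k n l) = k"
proof (cases "l + k \<le> Suc n")
  case True
  then have "cyclic_interval k n l = {l..<l + k}" using assms by (auto simp: cyclic_interval_def)
  then show ?thesis by simp
next
  case False
  then have "cyclic_interval k n l = {l..n} \<union> {1..<l + k - n}"
    using assms by (auto simp: cyclic_interval_def)
  moreover have "{l..n} \<inter> {1..<l + k - n} = {}" using assms by auto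
  ultimately show ?thesis using False assms by (simp add: card_Un_disjoint)
qed

text \<open>Given a common point, let \<open>l0\<close> be the start farthest behind it. Its
  interval has \<open>k\<close> points, and \<open>card L\<close> of them are missing from some
  other interval: the point just before each other start, and the point two before one of these
  starts, \<open>l1\<close>. Non-adjacency keeps them distinct and inside the interval of
  \<open>l0\<close>. If there is no common point, the claim is \<open>card L \<le> k\<close>
  itself.\<close>

lemma Inter_cyclic_interval:
  assumes nk: "2 \<le> k" "k + 2 \<le> n" and L: "L \<subseteq> {1..n}" "nonadjacent n A" "L \<subseteq> A"
    and cL: "2 \<le> card L" "card L \<le> k"
  shows "card (\<Inter>l\<in>L. cyclic_interval k n l) + card L \<le> k"
proof (cases "(\<Inter>l\<in>L. cyclic_interval k n l) = {}")
  case True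
  then show ?thesis using cL by simp
next
  case False
  let ?C = "cyclic_interval k n" and ?W = "\<Inter>l\<in>L. cyclic_interval k n l"
  obtain x where x: "\<And>l. l \<in> L \<Longrightarrow> x \<in> ?C l" using False by blast
  have finL: "finite L" and ne: "L \<noteq> {}" using cL by (auto intro: card_ge_0_finite)
  then have xn: "1 \<le> x" "x \<le> n" using x by (auto simp: cyclic_interval_def)
  \<comment> \<open>\<open>e l\<close> is the number of steps from \<open>l\<close> forward to \<open>x\<close>, and \<open>p s\<close> lies \<open>s\<close> steps before \<open>x\<close>.\<close>
  define e where "e l = (if l \<le> x then x - l else x + n - l)" for l
  define p where "p s = (if s < x then x - s else x + n - s)" for s
  have e_less: "e l < k" if "l \<in> L" for l
    using x[OF that] L(1) that nk by (auto simp: cyclic_interval_def e_def)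
  have pe: "p (e l) = l" if "l \<in> {1..n}" for l
    using that xn by (auto simp: p_def e_def)
  have inj_e: "inj_on e L" using pe L(1) by (metis inj_onI subsetD)
  have inj_p: "inj_on p {..<n}" using xn by (auto simp: inj_on_def p_def split: if_splits)
  have pred: "p (Suc (e l)) = (if l = 1 then n else l - 1)" if "l \<in> L" for l
    using e_less[OF that] L(1) that xn nk by (auto simp: p_def e_def split: if_splits)
  have gap: "e l' \<noteq> Suc (e l)" if "l \<in> L" "l' \<in> L" for l l'
  proof
    assume "e l' = Suc (e l)"
    then have "l' = (if l = 1 then n else l - 1)" using pred[OF that(1)] pe[of l'] that L(1) by auto
    then show False using that L(2,3) by (auto simp: nonadjacent_def)
  qed
  have before: "p (Suc (e l)) \<notin> ?C l" if "l \<in> L" for l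
    using pred[OF that] that L(1) nk by (auto simp: cyclic_interval_def)
  \<comment> \<open>By \<open>k + 2 \<le> n\<close> the interval, going round, stops short of the
    point two steps before its start.\<close>
  have before2: "p (e l + 2) \<notin> ?C l" if "l \<in> L" for l
    using e_less[OF that] L(1) that xn nk by (auto simp: cyclic_interval_def p_def e_def split: if_splits)
  have within: "p s \<in> ?C l" if "l \<in> L" "s \<le> e l" for l s
    using e_less[OF that(1)] L(1) that xn nk
    by (auto simp: cyclic_interval_def p_def e_def split: if_splits)
  have "Max (e ` L) \<in> e ` L" using finL ne by simp
  then obtain l0 where l0: "l0 \<in> L" "e l0 = Max (e ` L)" by auto
  have far: "e l + 2 \<le> e l0" if "l \<in> L - {l0}" for l
  proof -
    have "e l \<le> e l0" using that finL l0(2) by simp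
    moreover have "e l \<noteq> e l0" using that l0(1) inj_e by (auto dest: inj_onD)
    moreover have "e l0 \<noteq> Suc (e l)" using gap that l0(1) by blast
    ultimately show ?thesis by linarith
  qed
  have cL0: "card (L - {l0}) = card L - 1" using finL l0(1) by simp
  then have "card (L - {l0}) > 0" using cL by linarith
  then have "L - {l0} \<noteq> {}" by (metis card.empty less_irrefl)
  then obtain l1 where l1: "l1 \<in> L - {l0}" by blast
  define S where "S = insert (e l1 + 2) ((\<lambda>l. Suc (e l)) ` (L - {l0}))"
  \<comment> \<open>Equality would put \<open>l\<close> one step before \<open>l1\<close>.\<close>
  have "e l1 + 2 \<noteq> Suc (e l)" if "l \<in> L" for l using gap[of l1 l] l1 that by auto
  then have "e l1 + 2 \<notin> (\<lambda>l. Suc (e l)) ` (L - {l0})" by blast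
  moreover have "inj_on (\<lambda>l. Suc (e l)) (L - {l0})" using inj_e by (auto simp: inj_on_def)
  ultimately have cS: "card S = card L" and finS: "finite S"
    using cL0 cL finL by (simp_all add: S_def card_image)
  have S_le: "s \<le> e l0" if "s \<in> S" for s using that far far[OF l1] by (fastforce simp: S_def)
  then have "S \<subseteq> {..<n}" using e_less[OF l0(1)] nk by fastforce
  then have cpS: "card (p ` S) = card L" using card_image[OF inj_on_subset[OF inj_p]] cS by simp
  have sub: "p ` S \<subseteq> ?C l0" using within[OF l0(1)] S_le by blast
  have "p s \<notin> ?W" if "s \<in> S" for s
    using that before before2[of l1] l1 by (auto simp: S_def)
  then have "?W \<subseteq> ?C l0 - p ` S" using l0(1) by blast
  moreover have fin: "finite (?C l0)" by (simp add: cyclic_interval_def)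
  ultimately have "card ?W \<le> card (?C l0 - p ` S)" by (intro card_mono) auto
  also have "\<dots> = k - card L"
    using card_Diff_subset[of "p ` S" "?C l0"] sub finS cpS card_cyclic_interval[of l0 n k] l0(1) L(1) nk
    by auto
  finally show ?thesis using cL by linarith
qed

section \<open>Sign changes and a discrete Rolle theorem\<close>

text \<open>\<open>s\<close> is the last nonzero entry seen, or 0 at the beginning; zeros are
  skipped, so only strict changes between nonzero entries count.\<close>

primrec sign_changes :: "real \<Rightarrow> real list \<Rightarrow> nat" where
  "sign_changes s [] = 0"
| "sign_changes s (x # xs) =
     (if x = 0 then sign_changes s xs else of_bool (s * x < 0) + sign_changes x xs)"

primrec last_nonzero :: "real \<Rightarrow> real list \<Rightarrow> real" where
  "last_nonzero s [] = s"
| "last_nonzero s (x # xs) = last_nonzero (if x = 0 then s else x) xs"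

text \<open>Rows are listed by decreasing column, so the column of \<open>a\<close> is one more than
  the number of entries that follow, and this indexes its weight. The value before the first entry
  is \<open>b\<close>, the one after the last is 0.\<close>

primrec weighted_diff :: "(nat \<Rightarrow> real) \<Rightarrow> real \<Rightarrow> real list \<Rightarrow> real list" where
  "weighted_diff W b [] = [b]"
| "weighted_diff W b (a # as) = (b - W (Suc (length as)) * a) # weighted_diff W a as"

lemma sign_changes_append:
  "sign_changes s (xs @ ys) = sign_changes s xs + sign_changes (last_nonzero s xs) ys"
  by (induction xs arbitrary: s) auto

lemma sign_changes_uminus: "sign_changes (- s) (map uminus xs) = sign_changes s xs"
  by (induction xs arbitrary: s) auto

lemma last_nonzero_uminus: "last_nonzero (- s) (map uminus xs) = - last_nonzero s xs"
proof (induction xs arbitrary: s)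
  case (Cons x xs)
  show ?case using Cons[of s] Cons[of x] by simp
qed simp

lemma sign_changes_zeros: "\<forall>x\<in>set xs. x = 0 \<Longrightarrow> sign_changes s xs = 0"
  by (induction xs) auto

lemma last_nonzero_zeros: "\<forall>x\<in>set xs. x = 0 \<Longrightarrow> last_nonzero s xs = s"
  by (induction xs) auto

lemma weighted_diff_zeros:
  "\<forall>x\<in>set xs. x = 0 \<Longrightarrow> \<forall>x\<in>set (weighted_diff W 0 xs). x = 0"
  by (induction xs) auto

lemma same_sign_transfer:
  fixes a b e s :: real
  assumes "b * e > 0" and "b * a < 0"
  shows "e \<noteq> 0" and "s * e < 0 \<longleftrightarrow> s * b < 0" and "e * a < 0"
  using assms by (auto simp: zero_less_mult_iff mult_less_0_iff)

lemma nonneg_mult_transfer: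
  fixes a b s :: real
  assumes "b \<noteq> 0" and "a \<noteq> 0" and "\<not> b * a < 0"
  shows "s * b < 0 \<longleftrightarrow> s * a < 0"
  using assms by (auto simp: mult_less_0_iff not_less)

lemma neg_mult_split:
  fixes a e s :: real
  assumes "e \<noteq> 0" and "s * a < 0"
  shows "s * e < 0 \<or> e * a < 0"
  using assms by (auto simp: mult_less_0_iff not_less)

lemma pos_scale_neg:
  fixes s a w :: real
  assumes "w > 0"
  shows "s * (w * a) > 0 \<longleftrightarrow> s * a > 0"
  using assms zero_less_mult_iff[of w "s * a"] by (simp add: mult.left_commute)

text \<open>The two claims call each other: a zero entry leads from the first to the second, the
  first nonzero entry back. Where neighbours have opposite signs, the difference keeps the sign of
  the earlier one, so no change is lost; behind the initial 0, the first nonzero difference is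
  opposite to its entry, which yields the extra change. The sign \<open>- s\<close> reflects that
  each new row reverses all earlier entries; \<open>cs\<close> is a tail that the row leaves
  alone.\<close>

lemma sign_changes_weighted_diff:
  assumes W: "\<And>j. W j > 0"
  shows "b \<noteq> 0 \<Longrightarrow>
      of_bool (s * b < 0) + sign_changes b (as @ cs) \<le> sign_changes s (weighted_diff W b as @ cs)"
    and "\<exists>a\<in>set as. a \<noteq> 0 \<Longrightarrow>
      Suc (sign_changes (- s) (as @ cs)) \<le> sign_changes s (weighted_diff W 0 as @ cs)"
proof (induction as arbitrary: b s)
  case Nil
  {
    case 1
    then show ?case by simp
  next
    case 2
    then show ?case by simp
  }
next
  case (Cons a as)
  let ?w = "W (Suc (length as))"
  have w: "?w > 0" by (rule W)
  {
    case 1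
    show ?case
    proof (cases "a = 0")
      case True
      \<comment> \<open>Reversing the incoming sign costs at most one change, which the second claim
        gives back.\<close>
      have "sign_changes b (as @ cs) \<le> sign_changes b (weighted_diff W 0 as @ cs)"
      proof (cases "\<exists>a\<in>set as. a \<noteq> 0")
        case True
        then obtain a where a: "a \<in> set as" "a \<noteq> 0" by blast
        have "sign_changes b xs \<le> Suc (sign_changes (- b) xs)" for xs
          by (induction xs) auto
        from order_trans[OF this Cons(2)[OF True, of b]] show ?thesis .
      next
        case False
        then have z: "\<forall>a\<in>set as. a = 0" by blast
        show ?thesis
          unfolding sign_changes_append sign_changes_zeros[OF z] last_nonzero_zeros[OF z]
            sign_changes_zeros[OF weighted_diff_zeros[OF z]]
            last_nonzero_zeros[OF weighted_diff_zeros[OF z]] by simp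
      qed
      then show ?thesis using 1 True by simp
    next
      case False
      let ?e = "b - ?w * a"
      have IH: "\<And>s. of_bool (s * a < 0) + sign_changes a (as @ cs)
          \<le> sign_changes s (weighted_diff W a as @ cs)"
        using Cons(1)[OF False] .
      show ?thesis
      proof (cases "b * a < 0")
        case True
        have "b * ?e > 0"
        proof -
          have "?w * (b * a) < 0" using True w by (simp add: mult_pos_neg)
          moreover have "b * b > 0" using 1 not_real_square_gt_zero by blast
          ultimately show ?thesis by (simp add: algebra_simps)
        qed
        then have "?e \<noteq> 0" and "s * ?e < 0 \<longleftrightarrow> s * b < 0" and "?e * a < 0"
          using same_sign_transfer[OF _ True] by blast+
        then show ?thesis using IH[of ?e] True False by simp
      next
        case pos: False
        then have sab: "s * b < 0 \<longleftrightarrow> s * a < 0"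
          using nonneg_mult_transfer[OF 1 False pos] by blast
        show ?thesis
        proof (cases "?e = 0")
          case True
          then show ?thesis using IH[of s] False pos sab by simp
        next
          case e: False
          \<comment> \<open>A nonzero value placed between \<open>s\<close> and \<open>a\<close>
            cannot hide a change between them.\<close>
          have "of_bool (s * a < 0) \<le> of_bool (s * ?e < 0) + (of_bool (?e * a < 0) :: nat)"
            using neg_mult_split[OF e] by auto
          then show ?thesis using IH[of ?e] False pos sab e by simp
        qed
      qed
    qed
  next
    case 2
    show ?case
    proof (cases "a = 0")
      case True
      then show ?thesis using 2 Cons(2)[of s] by auto
    next
      case False
      have "of_bool (- (?w * a) * a < 0) + sign_changes a (as @ cs)
          \<le> sign_changes (- (?w * a)) (weighted_diff W a as @ cs)"
        using Cons(1)[OF False] .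
      moreover have "a * a > 0" using False not_real_square_gt_zero by blast
      then have "- (?w * a) * a < 0" using pos_scale_neg[OF w, of a a] by (simp add: mult.commute)
      moreover have "s * - (?w * a) < 0 \<longleftrightarrow> - s * a < 0"
        using pos_scale_neg[OF w, of s a] by simp
      ultimately show ?thesis using False w by simp
    qed
  }
qed

text \<open>
  A discrete Rolle theorem: passing to weighted differences of a sequence padded with zeros on
  both sides creates a new sign change.
\<close>

lemma sign_changes_step:
  assumes "\<And>j. W j > 0" and "\<exists>a\<in>set as. a \<noteq> 0"
  shows "Suc (sign_changes 0 (ys @ as @ cs))
    \<le> sign_changes 0 (map uminus ys @ weighted_diff W 0 as @ cs)"
proof -
  let ?l = "last_nonzero 0 ys"
  have "Suc (sign_changes ?l (as @ cs)) \<le> sign_changes (- ?l) (weighted_diff W 0 as @ cs)"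
    using sign_changes_weighted_diff(2)[OF assms, of "- ?l" cs] by simp
  moreover have "last_nonzero 0 (map uminus ys) = - ?l"
    using last_nonzero_uminus[of 0 ys] by simp
  moreover have "sign_changes 0 (map uminus ys) = sign_changes 0 ys"
    using sign_changes_uminus[of 0 ys] by simp
  moreover note sign_changes_append[of 0 ys "as @ cs"]
    sign_changes_append[of 0 "map uminus ys" "weighted_diff W 0 as @ cs"]
  ultimately show ?thesis by (metis add_Suc_right nat_add_left_cancel_le)
qed

lemma sign_changes_le_length_filter: "sign_changes s xs \<le> length (filter (\<lambda>x. x \<noteq> 0) xs)"
proof (induction xs arbitrary: s)
  case (Cons x xs)
  from Cons[of x] show ?case using Cons[of s] by (cases "s * x < 0") (auto simp: le_Suc_eq)
qed simp

lemma sign_changes_less_length_filter: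
  assumes "\<exists>x\<in>set xs. x \<noteq> 0"
  shows "sign_changes 0 xs < length (filter (\<lambda>x. x \<noteq> 0) xs)"
  using assms
proof (induction xs)
  case (Cons x xs)
  then show ?case using sign_changes_le_length_filter[of x xs] by (cases "x = 0") auto
qed simp

lemma sign_changes_eq_0:
  assumes "sign_changes s xs = 0"
  shows "(s \<ge> 0 \<and> (\<forall>x\<in>set xs. x \<ge> 0)) \<or> (s \<le> 0 \<and> (\<forall>x\<in>set xs. x \<le> 0))"
  using assms
proof (induction xs arbitrary: s)
  case (Cons x xs)
  show ?case
  proof (cases "x = 0")
    case True
    then show ?thesis using Cons by simp
  next
    case False
    then have "\<not> s * x < 0" and "sign_changes x xs = 0" using Cons.prems by (auto split: if_splits)
    then show ?thesis using Cons.IH[of x] False by (force simp: mult_less_0_iff not_less)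
  qed
qed auto

lemma sign_changes_triple:
  assumes "i < j" "j < l" "l < length xs" "\<sigma> * xs ! i < 0" "\<sigma> * xs ! j > 0" "\<sigma> * xs ! l < 0"
  shows "2 \<le> sign_changes 0 xs"
proof -
  \<comment> \<open>\<open>two\<close> looks ahead and \<open>rev\<close> looks back: on either side
    of the middle entry there is one of opposite sign, hence a change.\<close>
  have two: "0 < sign_changes s zs" if "i < length zs" "s * zs ! i < 0" for s i and zs :: "real list"
    using that
  proof (induction zs arbitrary: s i)
    case (Cons z zs)
    show ?case
    proof (cases "z = 0 \<or> s * z < 0")
      case True
      then show ?thesis using Cons by (cases i) auto
    next
      case False
      then obtain i' where i: "i = Suc i'" using Cons.prems by (cases i) auto
      then have "z * zs ! i' < 0" using Cons.prems False
        by (auto simp: mult_less_0_iff not_less)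
      then show ?thesis using Cons i False by auto
    qed
  qed simp
  define ys zs where "ys = take j xs" and "zs = drop (Suc j) xs"
  have xs: "xs = ys @ xs ! j # zs" using assms by (simp add: ys_def zs_def id_take_nth_drop)
  have "xs ! j \<noteq> 0" using assms by auto
  have "zs ! (l - Suc j) = xs ! l" "l - Suc j < length zs" using assms by (auto simp: zs_def)
  then have a: "0 < sign_changes (xs ! j) zs"
    using assms two[of "l - Suc j" zs "xs ! j"] by (auto simp: mult_less_0_iff zero_less_mult_iff)
  have rev: "0 < sign_changes s ys + of_bool (last_nonzero s ys * x < 0)"
    if "i < length ys" "ys ! i * x < 0" for s x i and ys :: "real list"
    using that
  proof (induction ys arbitrary: s i)
    case (Cons y ys)
    show ?case
    proof (cases i)
      case 0
      then have "y * x < 0" "y \<noteq> 0" using Cons.prems by auto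
      moreover have "0 < sign_changes y ys + of_bool (last_nonzero y ys * x < 0)" if "y * x < 0" for y
        using that
      proof (induction ys arbitrary: y)
        case (Cons z ys)
        show ?case
        proof (cases "z = 0 \<or> y * z < 0")
          case True
          then show ?thesis using Cons by auto
        next
          case False
          then have "z * x < 0" using Cons.prems by (auto simp: mult_less_0_iff not_less)
          then show ?thesis using Cons.IH[of z] False by simp
        qed
      qed simp
      ultimately show ?thesis by (auto simp: add.assoc)
    next
      case (Suc i')
      then show ?thesis using Cons.IH[of i'] Cons.prems by (auto simp: add.assoc)
    qed
  qed simp
  have "ys ! i = xs ! i" "i < length ys" using assms by (auto simp: ys_def)
  then have "0 < sign_changes 0 ys + of_bool (last_nonzero 0 ys * xs ! j < 0)"
    using assms rev[of i ys "xs ! j" 0] by (auto simp: mult_less_0_iff zero_less_mult_iff)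
  then show ?thesis using a \<open>xs ! j \<noteq> 0\<close>
    by (subst xs) (auto simp: sign_changes_append of_bool_def split: if_splits)
qed

text \<open>Bridges the row relation of the grid and the list operation: with \<open>b = 0\<close>
  the head becomes minus the value at the source of the row, the tail the potentials entering the
  next row.\<close>

lemma weighted_diff_map_upt:
  assumes "1 \<le> q" and "h 1 = f 1" and "\<And>j. 1 \<le> j \<Longrightarrow> j < q \<Longrightarrow> h (Suc j) = f (Suc j) - W j * f j"
  shows "weighted_diff W b (map f (rev [1..<Suc q])) = (b - W q * f q) # map h (rev [1..<Suc q])"
  using assms
proof (induction q arbitrary: b rule: dec_induct)
  case (step q)
  have "[1..<Suc (Suc q)] = [1..<Suc q] @ [Suc q]" using step(1) by simp
  moreover have "length [1..<Suc q] = q" by simp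
  ultimately show ?case using step by (simp del: upt_Suc)
qed simp

section \<open>Potentials on the grid of wires\<close>

lemma map_rev_upt:
  "map f (rev [1..<Suc q]) = map (\<lambda>t. f (a + q - t)) [a..<a + q]"
  by (rule nth_equalityI) (simp_all add: rev_nth Suc_diff_Suc del: upt_Suc)

lemma length_filter_map_upt:
  "length (filter (\<lambda>x. x \<noteq> 0) (map f [a..<b])) = card {t \<in> {a..<b}. f t \<noteq> 0}"
proof -
  have "length (filter (\<lambda>x. x \<noteq> 0) (map f [a..<b])) = length (filter (\<lambda>t. f t \<noteq> 0) [a..<b])"
    by (simp add: filter_map o_def)
  also have "\<dots> = card (set (filter (\<lambda>t. f t \<noteq> 0) [a..<b]))"
    by (rule distinct_card[symmetric]) simp
  finally show ?thesis by simp
qed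

text \<open>
  Here \<open>u i j\<close> is the potential on the wire of column \<open>j\<close> (of \<open>m = n - k\<close>) as it enters row \<open>i\<close>, so
  \<open>u (k + 1)\<close> holds the values at the sinks; \<open>g i\<close> is the potential at the source of row \<open>i\<close>, and
  \<open>W i j\<close> the weight of the edge entering dot \<open>(i, j)\<close> from the right. In row 1, where any
  non-adjacent set of dots may be missing, only the resulting linear form \<open>M\<close> is recorded.
\<close>

locale wire_grid =
  fixes k m :: nat and A :: "nat set"
    and W u :: "nat \<Rightarrow> nat \<Rightarrow> real" and g M :: "nat \<Rightarrow> real"
  assumes k: "2 \<le> k" and m: "2 \<le> m"
    and no_successor: "\<And>a. a \<in> A \<Longrightarrow> Suc a \<notin> A"
    and no_wrap: "1 \<in> A \<Longrightarrow> k + m \<notin> A"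
    and W_pos: "\<And>i j. W i j > 0"
    and row: "\<And>i j. 2 \<le> i \<Longrightarrow> i \<le> k \<Longrightarrow> 1 \<le> j \<Longrightarrow> j < m \<Longrightarrow>
      u (Suc i) (Suc j) = u i (Suc j) -
        (if j = 1 \<and> m + i \<in> A \<or> i = k \<and> Suc j = m \<and> 1 \<in> A then 0 else W i j * u i j)"
    and column1: "\<And>i. 2 \<le> i \<Longrightarrow> i \<le> k \<Longrightarrow> u (Suc i) 1 = u i 1"
    and source: "\<And>i. 2 \<le> i \<Longrightarrow> i \<le> k \<Longrightarrow>
      g i = (if i = k \<and> 1 \<in> A then W i (m - 1) * u i (m - 1) else W i m * u i m)"
    and source1: "g 1 = (\<Sum>j=1..m. M j * u 2 j)"
    and M_pos: "\<And>j. 1 \<le> j \<Longrightarrow> j \<le> m \<Longrightarrow> m + 2 - j \<notin> A \<Longrightarrow> M j > 0"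
    and M_zero: "\<And>j. 1 \<le> j \<Longrightarrow> j \<le> m \<Longrightarrow> m + 2 - j \<in> A \<Longrightarrow> M j = 0"
begin

text \<open>
  \<open>level i\<close> is the kernel vector, in the order of the border labels, of the network formed by the
  rows above row \<open>i\<close>; \<open>coord\<close> is that of the whole network, where a missing corner box swaps the
  labels of row \<open>k\<close> and column \<open>m\<close>. Each new row flips the sign of all earlier source entries.
\<close>

definition heads :: "nat \<Rightarrow> real list" where
  "heads i = map (\<lambda>r. - ((-1) ^ (i - 1 - r) * g r)) [1..<i]"

definition level :: "nat \<Rightarrow> real list" where
  "level i = heads i @ map (u i) (rev [1..<Suc m])"

definition coord :: "nat \<Rightarrow> real" where
  "coord t =
     (if 1 \<in> A \<and> t = k then - u (Suc k) m
      else if 1 \<in> A \<and> t = Suc k then - g k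
      else if t \<le> k then - ((-1) ^ (k - t) * g t)
      else u (Suc k) (Suc (k + m) - t))"

definition next_level :: "nat \<Rightarrow> real list" where
  "next_level i = (if i = k then map coord [1..<Suc (k + m)] else level (Suc i))"

section \<open>Passing one row, in list form\<close>

lemma length_heads [simp]: "length (heads i) = i - 1"
  by (simp add: heads_def)

lemma heads_Suc:
  assumes "1 \<le> i"
  shows "heads (Suc i) = map uminus (heads i) @ [- g i]"
proof -
  have "(-1) ^ (i - r) * g r = - ((-1) ^ (i - 1 - r) * g r)" if "r < i" for r
  proof -
    have "i - r = Suc (i - 1 - r)" using that by simp
    then show ?thesis by simp
  qed
  then show ?thesis using assms by (simp add: heads_def)
qed

lemma coord_upt_no_corner:
  assumes "1 \<notin> A"
  shows "map coord [1..<Suc (k + m)] = level (Suc k)"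
proof -
  have "[1..<Suc (k + m)] = [1..<Suc k] @ [Suc k..<Suc k + m]"
    using upt_add_eq_append[of 1 "Suc k" m] by (simp del: upt_Suc)
  moreover have "map coord [Suc k..<Suc k + m] = map (u (Suc k)) (rev [1..<Suc m])"
    using assms unfolding map_rev_upt[of _ m "Suc k"] by (intro map_cong) (auto simp: coord_def)
  moreover have "map coord [1..<Suc k] = heads (Suc k)"
    using assms by (auto simp: coord_def heads_def)
  ultimately show ?thesis by (simp add: level_def del: upt_Suc)
qed

text \<open>Without the corner dot the wire of column \<open>m\<close> bypasses row
  \<open>k\<close>, and its sink precedes the source of the row. Hence \<open>u k m\<close> joins
  the reversed prefix, and the row acts on the other \<open>m - 1\<close> wires only; its first dot
  is present by \<open>no_wrap\<close>.\<close>

lemma coord_upt_corner: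
  assumes "1 \<in> A"
  shows "map coord [1..<Suc (k + m)] =
    map uminus (heads k @ [u k m]) @ weighted_diff (W k) 0 (map (u k) (rev [1..<m]))"
proof -
  obtain q where q: "m = Suc q" "1 \<le> q" using m by (cases m) auto
  have "[1..<Suc (k + m)] = [1..<k] @ [k, Suc k] @ [Suc (Suc k)..<Suc (Suc k) + q]"
    using upt_add_eq_append[of 1 k "Suc m"] k
    by (simp add: q upt_conv_Cons[of k] upt_conv_Cons[of "Suc k"] del: upt_Suc)
  moreover have "coord k = - u k m" using row[of k "m - 1"] assms k m by (simp add: coord_def)
  moreover have "coord (Suc k) = - g k" using assms by (simp add: coord_def)
  moreover have "map coord [1..<k] = map uminus (heads k)"
  proof -
    have "coord t = (-1) ^ (k - 1 - t) * g t" if "t < k" for t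
    proof -
      have "k - t = Suc (k - 1 - t)" using that by simp
      then show ?thesis using that by (simp add: coord_def)
    qed
    then show ?thesis by (simp add: heads_def)
  qed
  moreover have "map coord [Suc (Suc k)..<Suc (Suc k) + q] = map (u (Suc k)) (rev [1..<Suc q])"
  proof -
    have "coord t = u (Suc k) (Suc (Suc k) + q - t)" if "Suc (Suc k) \<le> t" for t
      unfolding coord_def using that q by simp
    then show ?thesis unfolding map_rev_upt[of _ q "Suc (Suc k)"] by (intro map_cong) auto
  qed
  moreover have "weighted_diff (W k) 0 (map (u k) (rev [1..<m])) =
      - g k # map (u (Suc k)) (rev [1..<Suc q])"
    using weighted_diff_map_upt[of q "u (Suc k)" "u k" "W k" 0] row[of k] column1[of k]
      no_wrap[OF assms] source[of k] assms k q by (simp add: add.commute del: upt_Suc)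
  moreover have "[1..<Suc (k + m)] = [1..<k] @ [k, Suc k] @ [Suc (Suc k)..<Suc (Suc k) + q]"
    using calculation(1) .
  ultimately show ?thesis by (simp del: upt_Suc)
qed

lemma level_Suc_full:
  assumes "2 \<le> i" "i \<le> k" "\<not> (i = k \<and> 1 \<in> A)" "m + i \<notin> A"
  shows "level (Suc i) = map uminus (heads i) @ weighted_diff (W i) 0 (map (u i) (rev [1..<Suc m]))"
proof -
  have "weighted_diff (W i) 0 (map (u i) (rev [1..<Suc m])) =
      - g i # map (u (Suc i)) (rev [1..<Suc m])"
    using weighted_diff_map_upt[of m "u (Suc i)" "u i" "W i" 0] row[of i] column1[of i]
      source[of i] assms m by (auto simp del: upt_Suc)
  then show ?thesis using heads_Suc[of i] assms by (simp add: level_def)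
qed

text \<open>The row acts on the wires from column 2 on, with weights shifted by one; the first wire
  bypasses it and stays behind as an unchanged tail.\<close>

lemma level_Suc_missing:
  assumes "2 \<le> i" "i \<le> k" "\<not> (i = k \<and> 1 \<in> A)" "m + i \<in> A"
  shows "level (Suc i) = map uminus (heads i) @
    weighted_diff (\<lambda>j. W i (Suc j)) 0 (map (u i) (rev [2..<Suc m])) @ [u i 1]"
proof -
  obtain q where q: "m = Suc q" "1 \<le> q" using m by (cases m) auto
  have shift: "map f (rev [2..<Suc m]) = map (\<lambda>j. f (Suc j)) (rev [1..<Suc q])" for f :: "nat \<Rightarrow> real"
  proof -
    have "[2..<Suc m] = map Suc [1..<Suc q]" by (simp add: q map_Suc_upt numeral_2_eq_2 del: upt_Suc)
    then show ?thesis by (simp add: rev_map del: upt_Suc)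
  qed
  have "weighted_diff (\<lambda>j. W i (Suc j)) 0 (map (\<lambda>j. u i (Suc j)) (rev [1..<Suc q])) =
      (0 - W i (Suc q) * u i (Suc q)) # map (\<lambda>j. u (Suc i) (Suc j)) (rev [1..<Suc q])"
  proof (rule weighted_diff_map_upt)
    show "u (Suc i) (Suc 1) = u i (Suc 1)" using row[of i 1] assms q by simp
    show "u (Suc i) (Suc (Suc j)) = u i (Suc (Suc j)) - W i (Suc j) * u i (Suc j)"
      if "1 \<le> j" "j < q" for j
      using row[of i "Suc j"] assms q that by auto
  qed (use q in simp)
  then have "weighted_diff (\<lambda>j. W i (Suc j)) 0 (map (u i) (rev [2..<Suc m])) =
      - g i # map (u (Suc i)) (rev [2..<Suc m])"
    using source[of i] assms unfolding shift by (auto simp: q)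
  moreover have "rev [1..<Suc m] = rev [2..<Suc m] @ [1]"
    using m upt_conv_Cons[of 1 "Suc m"] by (simp add: numeral_2_eq_2 del: upt_Suc)
  ultimately show ?thesis using heads_Suc[of i] column1[of i] assms
    by (simp add: level_def del: upt_Suc)
qed

text \<open>A row adds a sign change as soon as a wire that meets one of its dots is nonzero;
  \<open>j2\<close> and \<open>jm\<close> exclude the bypassing wires. An arbitrary prefix length
  \<open>q\<close> is allowed because one alternative of the invariant below counts changes only
  from a given position on.\<close>

lemma gain:
  assumes i: "2 \<le> i" "i \<le> k" and j: "1 \<le> j" "j \<le> m" "u i j \<noteq> 0"
    and j2: "m + i \<in> A \<Longrightarrow> 2 \<le> j" and jm: "i = k \<Longrightarrow> 1 \<in> A \<Longrightarrow> j < m" and q: "q \<le> i - 1"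
  shows "Suc (sign_changes 0 (drop q (level i))) \<le> sign_changes 0 (drop q (next_level i))"
proof -
  have drop_uminus: "drop q (map uminus xs) = map uminus (drop q xs)" for xs :: "real list"
    by (simp add: drop_map)
  consider "i = k \<and> 1 \<in> A" | "\<not> (i = k \<and> 1 \<in> A)" "m + i \<notin> A" | "\<not> (i = k \<and> 1 \<in> A)" "m + i \<in> A"
    by blast
  then show ?thesis
  proof cases
    case 1
    have nz: "\<exists>a\<in>set (map (u k) (rev [1..<m])). a \<noteq> 0" using j jm 1 by (auto simp del: upt_Suc)
    have "level k = heads k @ [u k m] @ map (u k) (rev [1..<m])" using m by (simp add: level_def)
    then have "drop q (level i) = drop q (heads k @ [u k m]) @ map (u k) (rev [1..<m])"
      using q 1 by simp
    moreover have "drop q (next_level i) = map uminus (drop q (heads k @ [u k m])) @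
        weighted_diff (W k) 0 (map (u k) (rev [1..<m]))"
      using q 1 coord_upt_corner unfolding next_level_def by (simp add: drop_uminus del: upt_Suc)
    ultimately show ?thesis
      using sign_changes_step[OF W_pos nz, of "drop q (heads k @ [u k m])" "[]"] by simp
  next
    case 2
    then have "next_level i = level (Suc i)"
      using coord_upt_no_corner by (auto simp: next_level_def)
    then have "drop q (next_level i) = map uminus (drop q (heads i)) @
        weighted_diff (W i) 0 (map (u i) (rev [1..<Suc m]))"
      using q level_Suc_full[OF i 2] by (simp add: drop_uminus del: upt_Suc)
    moreover have "\<exists>a\<in>set (map (u i) (rev [1..<Suc m])). a \<noteq> 0"
      using j by (auto simp del: upt_Suc)
    ultimately show ?thesis
      using sign_changes_step[of "W i" "map (u i) (rev [1..<Suc m])" "drop q (heads i)" "[]"] W_pos q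
      by (simp add: level_def del: upt_Suc)
  next
    case 3
    then have "next_level i = level (Suc i)"
      using coord_upt_no_corner by (auto simp: next_level_def)
    then have "drop q (next_level i) = map uminus (drop q (heads i)) @
        weighted_diff (\<lambda>j. W i (Suc j)) 0 (map (u i) (rev [2..<Suc m])) @ [u i 1]"
      using q level_Suc_missing[OF i 3] by (simp add: drop_uminus del: upt_Suc)
    moreover have "\<exists>a\<in>set (map (u i) (rev [2..<Suc m])). a \<noteq> 0"
      using j j2 3 by (auto simp del: upt_Suc)
    moreover have "rev [1..<Suc m] = rev [2..<Suc m] @ [1]"
      using m upt_conv_Cons[of 1 "Suc m"] by (simp add: numeral_2_eq_2 del: upt_Suc)
    ultimately show ?thesis
      using sign_changes_step[of "\<lambda>j. W i (Suc j)" "map (u i) (rev [2..<Suc m])" "drop q (heads i)" "[u i 1]"] W_pos q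
      by (simp add: level_def del: upt_Suc)
  qed
qed

section \<open>Zeros, supports and signs along the rows\<close>

lemma zero_back:
  assumes "2 \<le> i" "i \<le> k" "\<And>j. 1 \<le> j \<Longrightarrow> j \<le> m \<Longrightarrow> u (Suc i) j = 0"
  shows "1 \<le> j \<Longrightarrow> j \<le> m \<Longrightarrow> u i j = 0"
proof (induction j rule: nat_induct_at_least)
  case base
  then show ?case using column1[of i] assms by simp
next
  case (Suc j)
  then show ?case using row[of i j] assms by (auto split: if_splits)
qed

text \<open>Each entry depends only on the one above it and that one's left neighbour, so a support
  grows by at most one column per row, to the right.\<close>

lemma support_spread:
  assumes s: "2 \<le> s" and supp: "\<And>j. 1 \<le> j \<Longrightarrow> j \<le> m \<Longrightarrow> u s j \<noteq> 0 \<Longrightarrow> p \<le> j \<and> j \<le> q"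
  shows "s \<le> i \<Longrightarrow> i \<le> Suc k \<Longrightarrow> 1 \<le> j \<Longrightarrow> j \<le> m \<Longrightarrow> u i j \<noteq> 0 \<Longrightarrow> p \<le> j \<and> j \<le> q + (i - s)"
proof (induction i arbitrary: j rule: nat_induct_at_least)
  case base
  then show ?case using supp by auto
next
  case (Suc i)
  show ?case
  proof (cases "j = 1")
    case True
    then show ?thesis using Suc column1[of i] s by fastforce
  next
    case False
    then obtain j' where j': "j = Suc j'" "1 \<le> j'" using Suc.prems by (cases j) auto
    then have "u i j \<noteq> 0 \<or> u i j' \<noteq> 0" using row[of i j'] Suc.prems Suc.hyps s
      by (auto split: if_splits)
    then show ?thesis using Suc.IH[of j] Suc.IH[of j'] Suc.prems Suc.hyps j' supp[of j] by fastforce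
  qed
qed

text \<open>Nothing nonzero ever appears to the left of column \<open>p\<close>, so no dot subtracts
  anything from its wire.\<close>

lemma first_nonzero_constant:
  assumes "2 \<le> s" and p: "1 \<le> p" "p \<le> m" "\<And>j. 1 \<le> j \<Longrightarrow> j < p \<Longrightarrow> u s j = 0"
  shows "s \<le> i \<Longrightarrow> i \<le> Suc k \<Longrightarrow> u i p = u s p"
proof (induction i rule: nat_induct_at_least)
  case (Suc i)
  show ?case
  proof (cases "p = 1")
    case True
    then show ?thesis using Suc column1[of i] assms by simp
  next
    case False
    then obtain p' where p': "p = Suc p'" "1 \<le> p'" using p by (cases p) auto
    have "p \<le> j \<and> j \<le> m" if "1 \<le> j" "j \<le> m" "u s j \<noteq> 0" for j
      using that p(3)[of j] by fastforce
    from support_spread[OF assms(1) this, of i p'] have "u i p' = 0" using Suc p p' by auto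
    then show ?thesis using row[of i p'] Suc p p' assms(1) by simp
  qed
qed simp

text \<open>The first wire is constant; row \<open>s\<close> puts a value of opposite sign on the
  second, and later rows only reinforce it. Hence a vector that lost a sign change on the first wire
  still has a nonzero second wire at any later missing dot of the first column.\<close>

lemma second_opposite:
  assumes s: "2 \<le> s" "m + s \<notin> A" and z: "u s 1 \<noteq> 0" "u s 2 = 0"
  shows "Suc s \<le> i \<Longrightarrow> i \<le> k \<Longrightarrow> u i 2 * u s 1 < 0"
proof (induction i rule: nat_induct_at_least)
  case base
  have "W s 1 * (u s 1 * u s 1) > 0"
    using W_pos[of s 1] z not_real_square_gt_zero[of "u s 1"] by (simp add: zero_less_mult_iff)
  moreover have "u (Suc s) 2 = - (W s 1 * u s 1)"
    using row[of s 1] s z base m by (simp add: numeral_2_eq_2)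
  ultimately show ?case by (simp add: algebra_simps)
next
  case (Suc i)
  have "u i 1 = u s 1" using first_nonzero_constant[of s 1 i] s m Suc by simp
  moreover have "W i 1 * (u s 1 * u s 1) > 0"
    using W_pos[of i 1] z not_real_square_gt_zero[of "u s 1"] by (simp add: zero_less_mult_iff)
  moreover have "u i 2 * u s 1 < 0" using Suc by simp
  moreover have "u (Suc i) 2 = u i 2 \<or> u (Suc i) 2 = u i 2 - W i 1 * u i 1"
    using row[of i 1] s Suc m by (auto simp: numeral_2_eq_2)
  ultimately show ?case by (auto simp: left_diff_distrib)
qed

text \<open>
  The invariant of the descent through the rows. Either all sign changes are present, or the vector
  stems from a single entry below a missing dot \<open>p\<close> of the top row, or from a missing dot in row
  \<open>s\<close> of the first column. In the last case the first \<open>s - 1\<close> entries are nonzero, and only the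
  sign changes after them are counted.
\<close>

definition good :: "nat \<Rightarrow> real list \<Rightarrow> bool" where
  "good i xs \<longleftrightarrow> i - 1 \<le> sign_changes 0 xs \<or>
     (\<exists>p\<in>{1..m}. m + 2 - p \<in> A \<and> u 2 p \<noteq> 0 \<and> (\<forall>j\<in>{1..m}. j \<noteq> p \<longrightarrow> u 2 j = 0) \<and>
        i - 2 \<le> sign_changes 0 xs) \<or>
     (\<exists>s\<ge>2. s < i \<and> m + s \<in> A \<and> u s 1 \<noteq> 0 \<and> (\<forall>j\<in>{2..m}. u s j = 0) \<and>
        (\<forall>r\<in>{1..<s}. g r \<noteq> 0) \<and> i - 1 - s \<le> sign_changes 0 (drop (s - 1) xs))"

lemma good_gain:
  assumes "2 \<le> i" and good: "good i xs"
    and gain: "\<And>q. q \<le> i - 1 \<Longrightarrow> Suc (sign_changes 0 (drop q xs)) \<le> sign_changes 0 (drop q ys)"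
  shows "good (Suc i) ys"
proof -
  have g0: "Suc (sign_changes 0 xs) \<le> sign_changes 0 ys" using gain[of 0] by simp
  from good[unfolded good_def] show ?thesis
  proof (elim disjE)
    assume "i - 1 \<le> sign_changes 0 xs"
    then have "Suc i - 1 \<le> sign_changes 0 ys" using g0 by linarith
    then show ?thesis unfolding good_def by blast
  next
    assume "\<exists>p\<in>{1..m}. m + 2 - p \<in> A \<and> u 2 p \<noteq> 0 \<and>
      (\<forall>j\<in>{1..m}. j \<noteq> p \<longrightarrow> u 2 j = 0) \<and> i - 2 \<le> sign_changes 0 xs"
    moreover have "Suc i - 2 \<le> sign_changes 0 ys" if "i - 2 \<le> sign_changes 0 xs"
      using that g0 by linarith
    ultimately show ?thesis unfolding good_def by blast
  next
    assume "\<exists>s\<ge>2. s < i \<and> m + s \<in> A \<and> u s 1 \<noteq> 0 \<and> (\<forall>j\<in>{2..m}. u s j = 0) \<and>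
        (\<forall>r\<in>{1..<s}. g r \<noteq> 0) \<and> i - 1 - s \<le> sign_changes 0 (drop (s - 1) xs)"
    then obtain s where s: "s \<ge> 2" "s < i" "m + s \<in> A" "u s 1 \<noteq> 0" "\<forall>j\<in>{2..m}. u s j = 0"
        "\<forall>r\<in>{1..<s}. g r \<noteq> 0" "i - 1 - s \<le> sign_changes 0 (drop (s - 1) xs)" by blast
    have "Suc i - 1 - s \<le> sign_changes 0 (drop (s - 1) ys)"
      using gain[of "s - 1"] s by linarith
    moreover have "s < Suc i" using s by simp
    ultimately show ?thesis using s unfolding good_def by blast
  qed
qed

text \<open>If no nonzero wire meets a dot of row \<open>i\<close>, the only nonzero one is the
  first wire at a missing first dot, or the last wire at the missing corner. Non-adjacency rules
  this out once a sign change has been lost before; the corner is reported as a separate outcome,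
  since no further row follows.\<close>

lemma good_step:
  assumes i: "2 \<le> i" "i \<le> k" and good: "good i (level i)"
    and nz: "1 \<le> j0" "j0 \<le> m" "u i j0 \<noteq> 0"
  shows "good (Suc i) (next_level i) \<or>
    i = k \<and> 1 \<in> A \<and> (\<forall>j. 1 \<le> j \<longrightarrow> j < m \<longrightarrow> u k j = 0) \<and> k - 1 \<le> sign_changes 0 (level k)"
proof (cases "\<exists>j. 1 \<le> j \<and> j \<le> m \<and> u i j \<noteq> 0 \<and> (m + i \<in> A \<longrightarrow> 2 \<le> j) \<and> (i = k \<and> 1 \<in> A \<longrightarrow> j < m)")
  case True
  then obtain j where "1 \<le> j" "j \<le> m" "u i j \<noteq> 0" "m + i \<in> A \<longrightarrow> 2 \<le> j" "i = k \<and> 1 \<in> A \<longrightarrow> j < m"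
    by blast
  then show ?thesis using good_gain[OF i(1) good, of "next_level i"] gain[OF i, of j] by blast
next
  case False
  then have F: "m + i \<in> A \<and> j < 2 \<or> i = k \<and> 1 \<in> A \<and> j = m"
    if "1 \<le> j" "j \<le> m" "u i j \<noteq> 0" for j
    using that by force
  show ?thesis
  proof (cases "m + i \<in> A")
    case True
    then have nc: "\<not> (i = k \<and> 1 \<in> A)" using no_wrap by (auto simp: add.commute)
    have z: "u i j = 0" if "2 \<le> j" "j \<le> m" for j using F[of j] that nc by fastforce
    have "j0 = 1" using z[of j0] nz by force
    then have u1: "u i 1 \<noteq> 0" using nz by simp
    have u2: "u i 2 = 0" using z[of 2] m by simp
    from good[unfolded good_def] show ?thesis
    proof (elim disjE)
      \<comment> \<open>Only \<open>u i 1\<close> and the \<open>i - 1\<close> heads can be nonzero,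
        and \<open>i - 1\<close> changes need \<open>i\<close> nonzero entries. So all heads are
        nonzero, and the third alternative begins with \<open>s = i\<close>, where it demands no
        further change yet.\<close>
      assume N: "i - 1 \<le> sign_changes 0 (level i)"
      have "rev [1..<Suc m] = rev [2..<Suc m] @ [1]"
        using m upt_conv_Cons[of 1 "Suc m"] by (simp add: numeral_2_eq_2 del: upt_Suc)
      moreover have "filter (\<lambda>x. x \<noteq> 0) (map (u i) (rev [2..<Suc m])) = []"
        using z by (auto simp: filter_empty_conv simp del: upt_Suc)
      ultimately have fl: "filter (\<lambda>x. x \<noteq> 0) (level i) = filter (\<lambda>x. x \<noteq> 0) (heads i) @ [u i 1]"
        using u1 by (simp add: level_def del: upt_Suc)
      have "u i 1 \<in> set (level i)" using m by (auto simp: level_def simp del: upt_Suc)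
      then have "\<exists>x\<in>set (level i). x \<noteq> 0" using u1 by blast
      from sign_changes_less_length_filter[OF this] N fl i
      have "length (heads i) \<le> length (filter (\<lambda>x. x \<noteq> 0) (heads i))" by simp
      then have "x \<noteq> 0" if "x \<in> set (heads i)" for x
        using length_filter_less[OF that, of "\<lambda>x. x \<noteq> 0"] by linarith
      then have "\<forall>r\<in>{1..<i}. g r \<noteq> 0" by (fastforce simp: heads_def)
      then have "good (Suc i) (next_level i)"
        unfolding good_def using i True u1 z by (intro disjI2 exI[of _ i]) auto
      then show ?thesis by blast
    next
      assume "\<exists>p\<in>{1..m}. m + 2 - p \<in> A \<and> u 2 p \<noteq> 0 \<and>
        (\<forall>j\<in>{1..m}. j \<noteq> p \<longrightarrow> u 2 j = 0) \<and> i - 2 \<le> sign_changes 0 (level i)"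
      then obtain p where p: "1 \<le> p" "p \<le> m" "m + 2 - p \<in> A" "u 2 p \<noteq> 0"
        "\<forall>j\<in>{1..m}. j \<noteq> p \<longrightarrow> u 2 j = 0" by auto
      \<comment> \<open>The wire \<open>p\<close> stays nonzero, so \<open>p = 1\<close> and the
        missing dot is the top left one, labelled \<open>m + 1\<close>. Then row 2 has its first
        dot, and the second wire is nonzero from row 3 on, contrary to \<open>u2\<close>.\<close>
      have "u i p = u 2 p" using first_nonzero_constant[of 2 p i] p i by simp
      then have p1: "p = 1" using z[of p] p by force
      have "m + 2 \<notin> A" using no_successor[of "m + 1"] p p1 by simp
      then show ?thesis
        using second_opposite[of 2 i] p p1 i m u2 True by (cases "i = 2") auto
    next
      assume "\<exists>s\<ge>2. s < i \<and> m + s \<in> A \<and> u s 1 \<noteq> 0 \<and> (\<forall>j\<in>{2..m}. u s j = 0) \<and>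
        (\<forall>r\<in>{1..<s}. g r \<noteq> 0) \<and> i - 1 - s \<le> sign_changes 0 (drop (s - 1) (level i))"
      then obtain s where s: "s \<ge> 2" "s < i" "m + s \<in> A" "u s 1 \<noteq> 0" "\<forall>j\<in>{2..m}. u s j = 0"
        by blast
      \<comment> \<open>The same argument, starting from the row after the earlier missing
        dot.\<close>
      have "m + Suc s \<notin> A" using no_successor[of "m + s"] s by simp
      moreover have "u (Suc s) 1 = u s 1" using column1[of s] s i by simp
      moreover have "u (Suc s) 2 = 0" using row[of s 1] s i m by (simp add: numeral_2_eq_2)
      ultimately show ?thesis
        using second_opposite[of "Suc s" i] s i u2 True by (cases "i = Suc s") auto
    qed
  next
    case False
    then have ik: "i = k" "1 \<in> A" using F[of j0] nz by auto
    have z: "u k j = 0" if "1 \<le> j" "j < m" for j using F[of j] that False ik by auto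
    from good[unfolded good_def] show ?thesis
    proof (elim disjE)
      assume "i - 1 \<le> sign_changes 0 (level i)"
      then show ?thesis using ik z by blast
    next
      assume "\<exists>p\<in>{1..m}. m + 2 - p \<in> A \<and> u 2 p \<noteq> 0 \<and>
        (\<forall>j\<in>{1..m}. j \<noteq> p \<longrightarrow> u 2 j = 0) \<and> i - 2 \<le> sign_changes 0 (level i)"
      then obtain p where p: "1 \<le> p" "p \<le> m" "m + 2 - p \<in> A" "u 2 p \<noteq> 0"
        "\<forall>j\<in>{1..m}. j \<noteq> p \<longrightarrow> u 2 j = 0" by auto
      \<comment> \<open>A lone wire in column \<open>m\<close> would lie below the box labelled 2, a
        neighbour of the corner label 1.\<close>
      have "u k p = u 2 p" using first_nonzero_constant[of 2 p k] p k by simp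
      then have "p = m" using z[of p] p by force
      then show ?thesis using no_successor[of 1] ik p by (simp add: numeral_2_eq_2)
    next
      assume "\<exists>s\<ge>2. s < i \<and> m + s \<in> A \<and> u s 1 \<noteq> 0 \<and> (\<forall>j\<in>{2..m}. u s j = 0) \<and>
        (\<forall>r\<in>{1..<s}. g r \<noteq> 0) \<and> i - 1 - s \<le> sign_changes 0 (drop (s - 1) (level i))"
      then obtain s where s: "s \<ge> 2" "s < i" "u s 1 \<noteq> 0" by blast
      have "u k 1 = u s 1" using first_nonzero_constant[of s 1 k] s i m by simp
      then show ?thesis using z[of 1] m s by simp
    qed
  qed
qed

text \<open>A lone wire below the missing dot gives the source of row 1 the value 0 and then widens
  by one column per row. It ends within the columns \<open>p\<close> to \<open>p + k - 1\<close> and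
  reaches the source of row \<open>i\<close> only if \<open>p + i - 2 \<ge> m\<close> (one less at a
  missing corner); in border labels these positions lie in the interval from
  \<open>m + 2 - p\<close>.\<close>

lemma support_top:
  assumes p: "1 \<le> p" "p \<le> m" "m + 2 - p \<in> A"
    and z: "\<And>j. 1 \<le> j \<Longrightarrow> j \<le> m \<Longrightarrow> j \<noteq> p \<Longrightarrow> u 2 j = 0"
    and t: "1 \<le> t" "t \<le> k + m" "coord t \<noteq> 0"
  shows "t \<in> cyclic_interval k (k + m) (m + 2 - p)"
proof -
  have "g 1 = 0" unfolding source1
  proof (rule sum.neutral, rule ballI)
    fix j assume "j \<in> {1..m}"
    then show "M j * u 2 j = 0" using z[of j] M_zero[of j] p by (cases "j = p") auto
  qed
  have sp: "p \<le> j \<and> j \<le> p + (i - 2)" if "2 \<le> i" "i \<le> Suc k" "1 \<le> j" "j \<le> m" "u i j \<noteq> 0" for i j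
    using support_spread[of 2 p p i j] z that by force
  have g: "m + 2 - p \<le> i \<or> i = k \<and> 1 \<in> A \<and> m + 2 - p \<le> Suc i"
    if i: "1 \<le> i" "i \<le> k" "g i \<noteq> 0" for i
  proof (cases "i = 1")
    case True
    then show ?thesis using \<open>g 1 = 0\<close> i by simp
  next
    case False
    then have "2 \<le> i" using i by simp
    then have "if i = k \<and> 1 \<in> A then u i (m - 1) \<noteq> 0 else u i m \<noteq> 0"
      using source[of i] i by (auto split: if_splits)
    moreover have "1 \<le> m - 1" "m - 1 \<le> m" "1 \<le> m" using m by auto
    ultimately show ?thesis using sp[of i m] sp[of i "m - 1"] \<open>2 \<le> i\<close> i
      by (auto split: if_splits)
  qed
  have last: "p \<le> j \<and> j \<le> p + (k - 1)" if "1 \<le> j" "j \<le> m" "u (Suc k) j \<noteq> 0" for j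
    using sp[of "Suc k" j] that k by simp
  consider "1 \<in> A" "t = k" | "1 \<in> A" "t = Suc k" | "\<not> (1 \<in> A \<and> t = k)" "t \<le> k"
    | "\<not> (1 \<in> A \<and> t = Suc k)" "t > k" by linarith
  then have "m + 2 - p \<le> t \<and> t < m + 2 - p + k"
  proof cases
    case 1
    then have "u (Suc k) m = u k m" "u (Suc k) m \<noteq> 0"
      using t row[of k "m - 1"] k m by (auto simp: coord_def)
    then have "m \<le> p + (k - 2)" using sp[of k m] k m by simp
    then show ?thesis using 1 k p by arith
  next
    case 2
    then have "g k \<noteq> 0" using t by (simp add: coord_def)
    then show ?thesis using g[of k] 2 p k by auto
  next
    case 3
    then have "g t \<noteq> 0" using t by (auto simp: coord_def)
    then show ?thesis using g[of t] 3 p t by auto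
  next
    case 4
    then have "u (Suc k) (Suc (k + m) - t) \<noteq> 0" using t by (auto simp: coord_def)
    then have "p \<le> Suc (k + m) - t \<and> Suc (k + m) - t \<le> p + (k - 1)"
      using last[of "Suc (k + m) - t"] 4 t by simp
    then show ?thesis using 4(2) p t(1,2) k by arith
  qed
  then show ?thesis using t by (simp add: cyclic_interval_def)
qed

text \<open>The wire bypasses row \<open>s\<close> and widens from row \<open>s + 1\<close> on, so
  it ends within the first \<open>k + 1 - s\<close> columns, whose labels start at
  \<open>m + s\<close>. The sources above row \<open>s\<close> are unrestricted: their labels, below
  \<open>s\<close>, are the wrapped part of the interval.\<close>

lemma support_left:
  assumes s: "2 \<le> s" "s \<le> k" "m + s \<in> A"
    and z: "\<And>j. 2 \<le> j \<Longrightarrow> j \<le> m \<Longrightarrow> u s j = 0"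
    and t: "1 \<le> t" "t \<le> k + m" "coord t \<noteq> 0"
  shows "t \<in> cyclic_interval k (k + m) (m + s)"
proof -
  have nc: "\<not> (s = k \<and> 1 \<in> A)" using s no_wrap by (auto simp: add.commute)
  have uz: "u (Suc s) j = 0" if j: "2 \<le> j" "j \<le> m" for j
  proof -
    obtain j' where j': "j = Suc j'" "1 \<le> j'" using j by (cases j) auto
    then show ?thesis using row[of s j'] z[of j'] z[of j] j s by (cases "j' = 1") auto
  qed
  have supp: "1 \<le> j \<and> j \<le> 1" if "1 \<le> j" "j \<le> m" "u (Suc s) j \<noteq> 0" for j
    using that uz[of j] by (cases "j = 1") auto
  have sp: "j \<le> i - s" if "s < i" "i \<le> Suc k" "1 \<le> j" "j \<le> m" "u i j \<noteq> 0" for i j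
    using support_spread[of "Suc s" 1 1 i j] supp that s by fastforce
  have g: "i < s \<or> m + s \<le> i \<or> i = k \<and> 1 \<in> A \<and> m + s \<le> Suc i"
    if i: "1 \<le> i" "i \<le> k" "g i \<noteq> 0" for i
  proof (cases "i < s")
    case False
    then have nz: "if i = k \<and> 1 \<in> A then u i (m - 1) \<noteq> 0 else u i m \<noteq> 0"
      using source[of i] i s by (auto split: if_splits)
    then have "i \<noteq> s" using z[of m] m nc by auto
    moreover have "1 \<le> m - 1" "m - 1 \<le> m" "1 \<le> m" using m by auto
    ultimately show ?thesis using nz sp[of i m] sp[of i "m - 1"] False i
      by (auto split: if_splits)
  qed simp
  consider "1 \<in> A" "t = k" | "1 \<in> A" "t = Suc k" | "\<not> (1 \<in> A \<and> t = k)" "t \<le> k"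
    | "\<not> (1 \<in> A \<and> t = Suc k)" "t > k" by linarith
  then have "m + s \<le> t \<or> t < s"
  proof cases
    case 1
    then have "u (Suc k) m = u k m" "u (Suc k) m \<noteq> 0"
      using t row[of k "m - 1"] k m by (auto simp: coord_def)
    then show ?thesis using sp[of k m] 1 k m s nc by force
  next
    case 2
    then have "g k \<noteq> 0" using t by (simp add: coord_def)
    then show ?thesis using g[of k] 2 s k nc by auto
  next
    case 3
    then have "g t \<noteq> 0" using t by (auto simp: coord_def)
    then show ?thesis using g[of t] 3 t by auto
  next
    case 4
    then have "u (Suc k) (Suc (k + m) - t) \<noteq> 0" using t by (auto simp: coord_def)
    then have "Suc (k + m) - t \<le> Suc k - s"
      using sp[of "Suc k" "Suc (k + m) - t"] 4 t s by simp
    then show ?thesis using 4(2) t(1,2) s(1,2) by arith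
  qed
  then show ?thesis using t s by (auto simp: cyclic_interval_def)
qed

text \<open>What remains is the bypassing wire of column \<open>m\<close>, whose sink has label
  \<open>k\<close>, and the sources of the rows above row \<open>k\<close>.\<close>

lemma support_corner:
  assumes "1 \<in> A" and z: "\<And>j. 1 \<le> j \<Longrightarrow> j < m \<Longrightarrow> u k j = 0"
    and t: "1 \<le> t" "t \<le> k + m" "coord t \<noteq> 0"
  shows "t \<in> cyclic_interval k (k + m) 1"
proof -
  have "g k = 0" using source[of k] z[of "m - 1"] assms(1) k m by simp
  moreover have "u (Suc k) j = 0" if j: "1 \<le> j" "j < m" for j
  proof (cases "j = 1")
    case True
    then show ?thesis using column1[of k] z[of 1] k m by simp
  next
    case False
    then obtain j' where j': "j = Suc j'" "1 \<le> j'" using j by (cases j) auto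
    then show ?thesis using row[of k j'] z[of j'] z[of j] j k by auto
  qed
  ultimately have "t \<le> k" using t assms(1)
    by (rule_tac ccontr) (auto simp: coord_def split: if_splits)
  then show ?thesis using t by (simp add: cyclic_interval_def)
qed

section \<open>The top row\<close>

lemma heads_2: "heads 2 = [- g 1]"
  by (simp add: heads_def numeral_2_eq_2)

text \<open>If \<open>level 2\<close> has no sign change, its entries agree in sign, but the source
  entry is minus a nonnegative combination of the others; so that combination vanishes, and every
  nonzero wire lies below a missing dot. A lone such wire is the second alternative of the
  invariant. With two of them, row 2 produces the sign pattern minus, plus, minus, and the full
  count is restored one row later.\<close>

lemma good_start:
  assumes "1 \<le> j0" "j0 \<le> m" "u 2 j0 \<noteq> 0"
  shows "good 2 (level 2) \<or> good 3 (next_level 2)"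
proof (cases "sign_changes 0 (level 2) = 0")
  case False
  then show ?thesis by (simp add: good_def)
next
  case True
  obtain \<sigma> :: real where \<sigma>: "\<sigma> = 1 \<or> \<sigma> = -1" and pos: "\<And>x. x \<in> set (level 2) \<Longrightarrow> \<sigma> * x \<ge> 0"
    using sign_changes_eq_0[OF True] that[of 1] that[of "-1"] by force
  have upos: "\<sigma> * u 2 j \<ge> 0" if "1 \<le> j" "j \<le> m" for j
    using pos[of "u 2 j"] that by (auto simp: level_def simp del: upt_Suc)
  have Mnn: "M j * (\<sigma> * u 2 j) \<ge> 0" if "j \<in> {1..m}" for j
  proof -
    have "M j \<ge> 0" using M_pos[of j] M_zero[of j] that by force
    then show ?thesis using upos[of j] that by simp
  qed
  have sg: "\<sigma> * g 1 = (\<Sum>j=1..m. M j * (\<sigma> * u 2 j))"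
    unfolding source1 by (simp add: sum_distrib_left mult.left_commute)
  moreover have "\<sigma> * g 1 \<le> 0" using pos[of "- g 1"] by (simp add: level_def heads_2)
  moreover have "(\<Sum>j=1..m. M j * (\<sigma> * u 2 j)) \<ge> 0" by (rule sum_nonneg) (rule Mnn)
  ultimately have "(\<Sum>j=1..m. M j * (\<sigma> * u 2 j)) = 0" by linarith
  then have "M j * (\<sigma> * u 2 j) = 0" if "j \<in> {1..m}" for j
    using sum_nonneg_eq_0_iff[of "{1..m}" "\<lambda>j. M j * (\<sigma> * u 2 j)"] Mnn that by blast
  then have inA: "m + 2 - j \<in> A" if "1 \<le> j" "j \<le> m" "u 2 j \<noteq> 0" for j
    using M_pos[of j] \<sigma> that by force
  have next0: "u 2 (Suc j) = 0" if "1 \<le> j" "j < m" "u 2 j \<noteq> 0" for j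
  proof -
    have "Suc (m + 2 - Suc j) = m + 2 - j" using that by simp
    then show ?thesis using no_successor[of "m + 2 - Suc j"] inA[of j] inA[of "Suc j"] that by auto
  qed
  show ?thesis
  proof (cases "\<exists>p\<in>{1..m}. u 2 p \<noteq> 0 \<and> (\<forall>j\<in>{1..m}. j \<noteq> p \<longrightarrow> u 2 j = 0)")
    case True
    then obtain p where "p \<in> {1..m}" "u 2 p \<noteq> 0" "\<forall>j\<in>{1..m}. j \<noteq> p \<longrightarrow> u 2 j = 0" by blast
    moreover from this have "m + 2 - p \<in> A" using inA[of p] by simp
    ultimately have "good 2 (level 2)" unfolding good_def by auto
    then show ?thesis by blast
  next
    case False
    moreover have "j0 \<in> {1..m}" using assms by simp
    ultimately obtain j1 where "j1 \<in> {1..m}" "j1 \<noteq> j0" "u 2 j1 \<noteq> 0" using assms by blast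
    then obtain p p' where p: "1 \<le> p'" "p' < p" "p \<le> m" "u 2 p \<noteq> 0" "u 2 p' \<noteq> 0"
      using assms that[of j0 j1] that[of j1 j0] by (cases "j0 < j1") auto
    then have p2: "Suc p' < p" using next0[of p'] by (cases "p = Suc p'") auto
    have spos: "\<sigma> * u 2 j > 0" if "1 \<le> j" "j \<le> m" "u 2 j \<noteq> 0" for j
      using upos[of j] that \<sigma> by force
    have wneg: "\<sigma> * - (W i j' * u 2 j) < 0" if "1 \<le> j" "j \<le> m" "u 2 j \<noteq> 0" for i j' j
    proof -
      have "\<sigma> * - (W i j' * u 2 j) = - (W i j' * (\<sigma> * u 2 j))" by (simp add: algebra_simps)
      then show ?thesis using mult_pos_pos[OF W_pos[of i j'] spos[OF that]] by linarith
    qed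
    have neg: "\<sigma> * u 3 (Suc j) < 0"
      if "1 \<le> j" "j < m" "u 2 j \<noteq> 0" "\<not> (k = 2 \<and> Suc j = m \<and> 1 \<in> A)" for j
    proof -
      have "\<not> (j = 1 \<and> m + 2 \<in> A)" using no_successor[of "m + 1"] inA[of j] that by auto
      then have "u 3 (Suc j) = - (W 2 j * u 2 j)"
        using row[of 2 j] next0[of j] that k by (auto simp: numeral_3_eq_3 numeral_2_eq_2)
      then show ?thesis using wneg[of j] that by simp
    qed
    have p3: "\<sigma> * u 3 p > 0"
    proof -
      obtain p0 where p0: "p = Suc p0" "1 \<le> p0" using p by (cases p) auto
      then have "u 2 p0 = 0" using next0[of p0] p by auto
      then have "u 3 p = u 2 p" using row[of 2 p0] p p0 k by (simp add: numeral_3_eq_3 numeral_2_eq_2)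
      then show ?thesis using spos[of p] p by simp
    qed
    \<comment> \<open>\<open>f\<close> reads off the next level by label, whether or not row 2 is
      the last row.\<close>
    define f where "f t = (if k = 2 then coord t
      else if t < 3 then - ((-1) ^ (2 - t) * g t) else u 3 (m + 3 - t))" for t
    have list: "next_level 2 = map f [1..<3 + m]"
    proof (cases "k = 2")
      case True
      then have "next_level 2 = map coord [1..<Suc (k + m)]" unfolding next_level_def by simp
      moreover have "f = coord" using True by (simp add: f_def fun_eq_iff)
      moreover have "Suc (k + m) = 3 + m" using True by simp
      ultimately show ?thesis by metis
    next
      case False
      have "[1..<3 + m] = [1..<3] @ [3..<3 + m]" using upt_add_eq_append[of 1 3 m] by simp
      moreover have "map f [1..<3] = heads 3" using False by (simp add: heads_def f_def)
      moreover have "map f [3..<3 + m] = map (u 3) (rev [1..<Suc m])"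
        unfolding map_rev_upt[of _ m 3] using False by (intro map_cong) (auto simp: f_def add.commute)
      moreover have "next_level 2 = level 3" using False by (simp add: next_level_def numeral_3_eq_3 numeral_2_eq_2)
      ultimately show ?thesis by (simp add: level_def del: upt_Suc)
    qed
    have pm: "p < m" if "1 \<in> A"
      using inA[of p] p no_successor[OF that] by (cases "p = m") (auto simp: numeral_2_eq_2)
    \<comment> \<open>The right neighbour of column \<open>p\<close> carries the first minus sign;
      if \<open>p\<close> is the last column with a dot in row 2, this is the entry of the
      source.\<close>
    have f1: "\<sigma> * f (m + 2 - p) < 0"
    proof -
      consider "k = 2" "1 \<in> A" "p = m - 1" | "\<not> (k = 2 \<and> 1 \<in> A)" "p = m"
        | "p < m" "\<not> (k = 2 \<and> 1 \<in> A \<and> Suc p = m)" using p pm by force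
      then show ?thesis
      proof cases
        case 1
        then have "f (m + 2 - p) = - (W 2 (m - 1) * u 2 (m - 1))"
          using source[of 2] p unfolding f_def coord_def by simp
        then show ?thesis using wneg[of p 2 "m - 1"] p 1 by simp
      next
        case 2
        then have "f (m + 2 - p) = - (W 2 m * u 2 m)"
          using source[of 2] k unfolding f_def coord_def by auto
        then show ?thesis using wneg[of p 2 m] p 2 by simp
      next
        case 3
        then have "f (m + 2 - p) = u 3 (Suc p)"
          using p unfolding f_def coord_def
          by (auto simp: numeral_3_eq_3 numeral_2_eq_2 Suc_diff_le)
        then show ?thesis using neg[of p] p 3 by auto
      qed
    qed
    have f2: "f (m + 3 - p) = u 3 p"
      using p p2 pm unfolding f_def coord_def by (auto simp: numeral_3_eq_3 numeral_2_eq_2)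
    have f3: "f (m + 2 - p') = u 3 (Suc p')"
      using p p2 pm unfolding f_def coord_def
      by (auto simp: numeral_3_eq_3 numeral_2_eq_2 Suc_diff_le)
    have nth: "map f [1..<3 + m] ! i = f (Suc i)" if "i < m + 2" for i
      using that by (simp del: upt_Suc)
    have "2 \<le> sign_changes 0 (map f [1..<3 + m])"
    proof (rule sign_changes_triple[of "m + 1 - p" "m + 2 - p" "m + 1 - p'" _ \<sigma>])
      show "\<sigma> * map f [1..<3 + m] ! (m + 1 - p) < 0"
        using f1 nth[of "m + 1 - p"] p by (simp add: Suc_diff_le)
      show "\<sigma> * map f [1..<3 + m] ! (m + 2 - p) > 0"
        using f2 p3 nth[of "m + 2 - p"] p by (simp add: Suc_diff_le numeral_3_eq_3)
      show "\<sigma> * map f [1..<3 + m] ! (m + 1 - p') < 0"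
        using f3 neg[of p'] nth[of "m + 1 - p'"] p p2 by (simp add: Suc_diff_le)
    qed (use p p2 in auto)
    then show ?thesis using list by (simp add: good_def)
  qed
qed

section \<open>Size of the support of a kernel vector\<close>

definition coord_support :: "nat set" where
  "coord_support = {t \<in> {1..k + m}. coord t \<noteq> 0}"

lemma card_coord_support:
  "card coord_support = length (filter (\<lambda>x. x \<noteq> 0) (map coord [1..<Suc (k + m)]))"
  unfolding length_filter_map_upt coord_support_def by (rule arg_cong[of _ _ card]) auto

lemma sign_changes_less_card_coord_support:
  assumes "0 < sign_changes 0 (next_level k)"
  shows "sign_changes 0 (next_level k) < card coord_support"
proof -
  have "\<exists>x\<in>set (next_level k). x \<noteq> 0" using sign_changes_zeros[of "next_level k" 0] assms by auto
  from sign_changes_less_length_filter[OF this] show ?thesis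
    unfolding card_coord_support next_level_def by simp
qed

lemma good_coord:
  assumes "good (Suc k) (next_level k)"
  shows "k < card coord_support \<or>
    (\<exists>l\<in>A. k \<le> card coord_support \<and> coord_support \<subseteq> cyclic_interval k (k + m) l)"
  using assms[unfolded good_def]
proof (elim disjE)
  assume "Suc k - 1 \<le> sign_changes 0 (next_level k)"
  then show ?thesis using sign_changes_less_card_coord_support k by simp
next
  assume "\<exists>p\<in>{1..m}. m + 2 - p \<in> A \<and> u 2 p \<noteq> 0 \<and>
    (\<forall>j\<in>{1..m}. j \<noteq> p \<longrightarrow> u 2 j = 0) \<and> Suc k - 2 \<le> sign_changes 0 (next_level k)"
  then obtain p where p: "1 \<le> p" "p \<le> m" "m + 2 - p \<in> A" "\<And>j. 1 \<le> j \<Longrightarrow> j \<le> m \<Longrightarrow> j \<noteq> p \<Longrightarrow> u 2 j = 0"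
    and sc: "Suc k - 2 \<le> sign_changes 0 (next_level k)" by auto
  have "0 < sign_changes 0 (next_level k)" using sc k by linarith
  from sign_changes_less_card_coord_support[OF this]
  have "k \<le> card coord_support" using sc k by linarith
  moreover have "coord_support \<subseteq> cyclic_interval k (k + m) (m + 2 - p)"
    using support_top[OF p] by (auto simp: coord_support_def)
  ultimately show ?thesis using p(3) by blast
next
  assume "\<exists>s\<ge>2. s < Suc k \<and> m + s \<in> A \<and> u s 1 \<noteq> 0 \<and> (\<forall>j\<in>{2..m}. u s j = 0) \<and>
      (\<forall>r\<in>{1..<s}. g r \<noteq> 0) \<and> Suc k - 1 - s \<le> sign_changes 0 (drop (s - 1) (next_level k))"
  then obtain s where s: "2 \<le> s" "s \<le> k" "m + s \<in> A" and u1: "u s 1 \<noteq> 0"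
    and z: "\<And>j. 2 \<le> j \<Longrightarrow> j \<le> m \<Longrightarrow> u s j = 0"
    and h: "\<And>r. 1 \<le> r \<Longrightarrow> r < s \<Longrightarrow> g r \<noteq> 0"
    and sc: "k - s \<le> sign_changes 0 (drop (s - 1) (next_level k))" by auto
  let ?nz = "\<lambda>x :: real. x \<noteq> 0"
  have drop: "drop (s - 1) (next_level k) = map coord [s..<Suc (k + m)]"
    using s by (simp add: next_level_def drop_map del: upt_Suc)
  have "u (Suc k) 1 = u s 1" using first_nonzero_constant[of s 1 "Suc k"] s m by simp
  then have "coord (k + m) \<noteq> 0" using u1 k m by (simp add: coord_def)
  then have "\<exists>x\<in>set (map coord [s..<Suc (k + m)]). x \<noteq> 0" using s by auto
  from sign_changes_less_length_filter[OF this]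
  have tail: "k - s < length (filter ?nz (map coord [s..<Suc (k + m)]))" using sc drop by simp
  have "coord t \<noteq> 0" if "1 \<le> t" "t < s" for t using h[of t] that s by (simp add: coord_def)
  then have "filter ?nz (map coord [1..<s]) = map coord [1..<s]" by (auto simp: filter_id_conv)
  then have head: "length (filter ?nz (map coord [1..<s])) = s - 1" by simp
  have "[1..<Suc (k + m)] = [1..<s] @ [s..<Suc (k + m)]"
    using upt_add_eq_append[of 1 s "Suc (k + m) - s"] s by simp
  then have "card coord_support = length (filter ?nz (map coord [1..<s]))
      + length (filter ?nz (map coord [s..<Suc (k + m)]))"
    unfolding card_coord_support by (metis filter_append length_append map_append)
  \<comment> \<open>There are \<open>s - 1\<close> nonzero entries before position \<open>s\<close>
    and at least \<open>k - s + 1\<close> from there on.\<close>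
  then have "k \<le> card coord_support" using head tail s by linarith
  moreover have "coord_support \<subseteq> cyclic_interval k (k + m) (m + s)"
    using support_left[OF s z] by (auto simp: coord_support_def)
  ultimately show ?thesis using s(3) by blast
qed

lemma row_nonzero:
  assumes nz: "\<exists>j. 1 \<le> j \<and> j \<le> m \<and> u 2 j \<noteq> 0"
  shows "2 \<le> i \<Longrightarrow> i \<le> Suc k \<Longrightarrow> \<exists>j. 1 \<le> j \<and> j \<le> m \<and> u i j \<noteq> 0"
proof (induction i rule: nat_induct_at_least)
  case base
  then show ?case using nz by simp
next
  case (Suc i)
  then show ?case using zero_back[of i] by (metis Suc_leD Suc_le_mono)
qed

theorem coord_support_cases:
  assumes nz: "1 \<le> j0" "j0 \<le> m" "u 2 j0 \<noteq> 0"
  shows "k < card coord_support \<or>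
    (\<exists>l\<in>A. k \<le> card coord_support \<and> coord_support \<subseteq> cyclic_interval k (k + m) l)"
proof -
  let ?C = "1 \<in> A \<and> (\<forall>j. 1 \<le> j \<longrightarrow> j < m \<longrightarrow> u k j = 0) \<and> k - 1 \<le> sign_changes 0 (level k)"
  have nl: "next_level i = level (Suc i)" if "i \<noteq> k" for i
    using that by (simp add: next_level_def)
  have step: "good (Suc i) (next_level i) \<or> i = k \<and> ?C" if "good i (level i)" "2 \<le> i" "i \<le> k" for i
    using good_step[OF that(2,3,1)] row_nonzero[of i] nz that by fastforce
  have "good (Suc k) (next_level k) \<or> ?C"
  proof -
    \<comment> \<open>The climb may start at level 2 or 3, as \<open>good_start\<close> can skip a
      level.\<close>
    have "good i (level i)" if "i0 \<le> i" "i \<le> k" "2 \<le> i0" "good i0 (level i0)" for i0 i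
      using that(1,2)
    proof (induction i rule: nat_induct_at_least)
      case base
      then show ?case using that by simp
    next
      case (Suc i)
      then show ?case using step[of i] nl[of i] that by auto
    qed
    note climb = this
    from good_start[OF nz] show ?thesis
    proof
      assume "good 2 (level 2)"
      then show ?thesis using climb[of 2 k] step[of k] k by simp
    next
      assume g3: "good 3 (next_level 2)"
      show ?thesis
      proof (cases "k = 2")
        case True
        then show ?thesis using g3 by (simp add: numeral_3_eq_3 numeral_2_eq_2)
      next
        case False
        then have "good 3 (level 3)" using g3 nl[of 2] by (simp add: numeral_3_eq_3 numeral_2_eq_2)
        then show ?thesis using climb[of 3 k] step[of k] False k by simp
      qed
    qed
  qed
  then show ?thesis
  proof
    assume "good (Suc k) (next_level k)"
    then show ?thesis by (rule good_coord)
  next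
    \<comment> \<open>The wires that meet row \<open>k\<close> are all zero, so the row only
      reverses signs; the remaining \<open>k - 1\<close> changes still need \<open>k\<close> nonzero
      entries.\<close>
    assume C: ?C
    have "\<forall>x\<in>set (map (u k) (rev [1..<m])). x = 0" using C by auto
    note z = weighted_diff_zeros[OF this, of "W k"]
    have "level k = (heads k @ [u k m]) @ map (u k) (rev [1..<m])" using m by (simp add: level_def)
    moreover have "sign_changes s (map (u k) (rev [1..<m])) = 0" for s
      using C by (intro sign_changes_zeros) auto
    ultimately have "sign_changes 0 (level k) = sign_changes 0 (heads k @ [u k m])"
      by (simp only: sign_changes_append[of 0 "heads k @ [u k m]"])
    moreover have "sign_changes 0 (next_level k) = sign_changes 0 (map uminus (heads k @ [u k m]))"
    proof -
      have "next_level k = map uminus (heads k @ [u k m]) @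
          weighted_diff (W k) 0 (map (u k) (rev [1..<m]))"
        unfolding next_level_def using coord_upt_corner C by simp
      then show ?thesis
        by (simp only: sign_changes_append[of 0 "map uminus (heads k @ [u k m])"]
            sign_changes_zeros[OF z])
    qed
    moreover have "sign_changes 0 (map uminus (heads k @ [u k m])) = sign_changes 0 (heads k @ [u k m])"
      using sign_changes_uminus[of 0 "heads k @ [u k m]"] by simp
    ultimately have "k - 1 \<le> sign_changes 0 (next_level k)" using C by linarith
    then have "k \<le> card coord_support" using sign_changes_less_card_coord_support k by linarith
    moreover have "coord_support \<subseteq> cyclic_interval k (k + m) 1"
      using support_corner C by (auto simp: coord_support_def)
    ultimately show ?thesis using C by blast
  qed
qed

end

section \<open>Path sums in acyclic digraphs\<close>

lemma awalk_Nil: "pre_digraph.awalk G u [] v \<longleftrightarrow> u \<in> verts G \<and> u = v"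
  by (auto simp: pre_digraph.awalk_def pre_digraph.cas.simps)

text \<open>A height that falls along arcs makes every walk a path with distinct vertices. Paths can
  thus be split at their first arc, which turns path sums into a linear recursion.\<close>

locale acyclic_pair_digraph =
  fixes G :: "'a pair_pre_digraph" and height :: "'a \<Rightarrow> nat" and f :: "'a \<times> 'a \<Rightarrow> real"
  assumes finite_arcs: "finite (parcs G)"
    and wf: "\<And>e. e \<in> parcs G \<Longrightarrow> fst e \<in> pverts G \<and> snd e \<in> pverts G"
    and height: "\<And>e. e \<in> parcs G \<Longrightarrow> height (snd e) < height (fst e)"
begin

abbreviation "walk u p v \<equiv> pre_digraph.awalk (with_proj G) u p v"

definition paths :: "'a \<Rightarrow> 'a \<Rightarrow> ('a \<times> 'a) list set" where
  "paths u v = {p. pre_digraph.apath (with_proj G) u p v}"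

definition path_sum :: "'a \<Rightarrow> 'a \<Rightarrow> real" where
  "path_sum u v = (\<Sum>p\<in>paths u v. prod_list (map f p))"

lemma walk_Cons: "walk u (e # p) v \<longleftrightarrow> e \<in> parcs G \<and> fst e = u \<and> walk (snd e) p v"
  using wf[of e] by (auto simp: pre_digraph.awalk_def pre_digraph.cas.simps)

lemma walk_heights:
  "walk u p v \<Longrightarrow> x \<in> set (pre_digraph.awalk_verts (with_proj G) u p) \<Longrightarrow> height x \<le> height u"
proof (induction p arbitrary: u)
  case Nil
  then show ?case by (simp add: pre_digraph.awalk_verts.simps)
next
  case (Cons e p)
  then have w: "walk (snd e) p v" and e: "e \<in> parcs G" "fst e = u" by (auto simp: walk_Cons)
  consider "x = u" | "x \<in> set (pre_digraph.awalk_verts (with_proj G) (snd e) p)"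
    using Cons.prems(2) e by (auto simp: pre_digraph.awalk_verts.simps)
  then show ?case
    using Cons.IH[OF w] height[OF e(1)] e(2) by cases auto
qed

lemma walk_distinct: "walk u p v \<Longrightarrow> distinct (pre_digraph.awalk_verts (with_proj G) u p)"
proof (induction p arbitrary: u)
  case Nil
  then show ?case by (simp add: pre_digraph.awalk_verts.simps)
next
  case (Cons e p)
  then have w: "walk (snd e) p v" and e: "e \<in> parcs G" "fst e = u" by (auto simp: walk_Cons)
  have "u \<notin> set (pre_digraph.awalk_verts (with_proj G) (snd e) p)"
    using walk_heights[OF w] height[OF e(1)] e(2) by fastforce
  then show ?case using Cons.IH[OF w] e by (simp add: pre_digraph.awalk_verts.simps)
qed

lemma paths_eq: "paths u v = {p. walk u p v}"
  using walk_distinct by (auto simp: paths_def pre_digraph.apath_def)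

lemma paths_self: "v \<in> pverts G \<Longrightarrow> paths v v = {[]}"
proof -
  assume v: "v \<in> pverts G"
  have "height v \<le> height u" if "walk u p v" for u p
    using that
  proof (induction p arbitrary: u)
    case Nil
    then show ?case by (simp add: awalk_Nil)
  next
    case (Cons e p)
    then show ?case using height[of e] by (fastforce simp: walk_Cons)
  qed
  then have "p = []" if "walk v p v" for p
    using that height by (cases p) (fastforce simp: walk_Cons)+
  then show ?thesis using v by (auto simp: paths_eq awalk_Nil)
qed

lemma paths_step:
  assumes "u \<noteq> v"
  shows "paths u v = (\<Union>e\<in>{e \<in> parcs G. fst e = u}. (#) e ` paths (snd e) v)"
proof -
  have "p \<in> paths u v \<longleftrightarrow> p \<in> (\<Union>e\<in>{e \<in> parcs G. fst e = u}. (#) e ` paths (snd e) v)" for p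
    using assms by (cases p) (auto simp: paths_eq awalk_Nil walk_Cons)
  then show ?thesis by blast
qed

lemma finite_paths: "finite (paths u v)"
proof (induction "height u" arbitrary: u rule: less_induct)
  case less
  show ?case
  proof (cases "u = v")
    case True
    then show ?thesis using paths_self[of v]
      by (cases "v \<in> pverts G") (auto simp: paths_eq pre_digraph.awalk_def)
  next
    case False
    have "finite (paths (snd e) v)" if "e \<in> parcs G" "fst e = u" for e
      using less height[of e] that by blast
    then show ?thesis unfolding paths_step[OF False] using finite_arcs by auto
  qed
qed

lemma path_sum_self: "v \<in> pverts G \<Longrightarrow> path_sum v v = 1"
  by (simp add: path_sum_def paths_self)

lemma path_sum_step:
  assumes "u \<noteq> v"
  shows "path_sum u v = (\<Sum>e\<in>{e \<in> parcs G. fst e = u}. f e * path_sum (snd e) v)"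
proof -
  have "path_sum u v = (\<Sum>e\<in>{e \<in> parcs G. fst e = u}. \<Sum>p\<in>(#) e ` paths (snd e) v. prod_list (map f p))"
    unfolding path_sum_def paths_step[OF assms]
    by (rule sum.UNION_disjoint) (use finite_arcs finite_paths in auto)
  also have "\<dots> = (\<Sum>e\<in>{e \<in> parcs G. fst e = u}. f e * path_sum (snd e) v)"
    by (rule sum.cong) (simp_all add: sum.reindex path_sum_def sum_distrib_left)
  finally show ?thesis .
qed

lemma path_sum_no_in_arcs:
  assumes "u \<noteq> v" and "\<And>e. e \<in> parcs G \<Longrightarrow> snd e \<noteq> v"
  shows "path_sum u v = 0"
proof -
  have "u' = v" if "walk u' p v" for u' p
    using that
  proof (induction p arbitrary: u')
    case Nil
    then show ?case by (simp add: awalk_Nil)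
  next
    case (Cons e p)
    then show ?case using Cons.IH[of "snd e"] assms(2)[of e] by (simp add: walk_Cons)
  qed
  then have "paths u v = {}" using assms(1) by (auto simp: paths_eq)
  then show ?thesis by (simp add: path_sum_def)
qed

end

section \<open>The network of the diagram\<close>

locale board =
  fixes k m :: nat and A :: "nat set" and w :: "vertex \<times> vertex \<Rightarrow> real"
  assumes k: "2 \<le> k" and m: "2 \<le> m"
    and A: "A \<subseteq> {1..k + m}" and nonadjacent: "nonadjacent (k + m) A"
    and weights: "positive_weights k (k + m) (diagram_of k (k + m) A) w"
begin

section \<open>Dots, sources and sinks in closed form\<close>

abbreviation "D \<equiv> diagram_of k (k + m) A"

definition dot :: "nat \<Rightarrow> nat \<Rightarrow> bool" where
  "dot i j \<longleftrightarrow> 1 \<le> i \<and> i \<le> k \<and> 1 \<le> j \<and> j \<le> m \<and> \<not> (i = k \<and> j = m \<and> 1 \<in> A) \<and>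
     \<not> (i = 1 \<and> m + 2 - j \<in> A) \<and> \<not> (j = 1 \<and> m + i \<in> A)"

definition src :: "nat \<Rightarrow> nat" where
  "src i = (if 1 \<in> A \<and> i = k then Suc k else i)"

definition snk :: "nat \<Rightarrow> nat" where
  "snk j = (if 1 \<in> A \<and> j = m then k else Suc (k + m) - j)"

lemma no_successor: "a \<in> A \<Longrightarrow> Suc a \<notin> A"
proof -
  assume a: "a \<in> A"
  show "Suc a \<notin> A"
  proof (cases "a = k + m")
    case True
    then show ?thesis using A by auto
  next
    case False
    then show ?thesis using a nonadjacent by (auto simp: nonadjacent_def)
  qed
qed

lemma no_wrap: "1 \<in> A \<Longrightarrow> k + m \<notin> A"
  using nonadjacent by (auto simp: nonadjacent_def)

lemma boxes_iff: "(i, j) \<in> boxes D \<longleftrightarrow>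
    1 \<le> i \<and> i \<le> k \<and> 1 \<le> j \<and> j \<le> m \<and> \<not> (1 \<in> A \<and> i = k \<and> j = m)"
  by (auto simp: diagram_of_def labeled_box_def)

lemma labeled_box_in:
  assumes "1 \<le> l" "l \<le> k + m"
  shows "labeled_box k (k + m) l = (i, j) \<and> 1 \<le> i \<and> i \<le> k \<and> 1 \<le> j \<and> j \<le> m \<longleftrightarrow>
    1 \<le> i \<and> i \<le> k \<and> 1 \<le> j \<and> j \<le> m \<and>
    (l = 1 \<and> i = k \<and> j = m \<or> i = 1 \<and> l = m + 2 - j \<or> j = 1 \<and> l = m + i)"
  using assms k m by (auto simp: labeled_box_def)

lemma dots_iff: "(i, j) \<in> dots D \<longleftrightarrow> dot i j"
proof -
  have "(i, j) \<in> labeled_box k (k + m) ` A \<longleftrightarrow> (\<exists>l\<in>A. labeled_box k (k + m) l = (i, j))"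
    by (metis image_iff)
  moreover have "labeled_box k (k + m) l = (i, j) \<longleftrightarrow>
      l = 1 \<and> i = k \<and> j = m \<or> i = 1 \<and> l = m + 2 - j \<or> j = 1 \<and> l = m + i"
    if "l \<in> A" "1 \<le> i \<and> i \<le> k \<and> 1 \<le> j \<and> j \<le> m" for l
    using labeled_box_in[of l i j] A that by auto
  ultimately show ?thesis by (auto simp: diagram_of_def dot_def)
qed

lemma le_diagram: "le_diagram k (k + m) D"
proof -
  have 1: "boxes D \<subseteq> {1..k} \<times> {1..k + m - k}" by (auto simp: boxes_iff)
  have 2: "(i, j) \<in> boxes D" if "(i', j') \<in> boxes D" "1 \<le> i" "i \<le> i'" "1 \<le> j" "j \<le> j'" for i j i' j'
    using that by (auto simp: boxes_iff)
  have 3: "dots D \<subseteq> boxes D" by (auto simp: boxes_iff dots_iff dot_def)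
  have 4: "(i', j') \<in> dots D"
    if "i < i'" "j < j'" "(i', j') \<in> boxes D" "(i, j') \<in> dots D" "(i', j) \<in> dots D" for i j i' j'
    using that by (auto simp: boxes_iff dots_iff dot_def)
  show ?thesis unfolding le_diagram_def using 1 2 3 4 by blast
qed

lemma border_eq:
  "t \<le> k + m \<Longrightarrow> border k (k + m) D t =
     (if 1 \<notin> A then (if t \<le> k then (t, m) else (k, k + m - t))
      else if t < k then (t, m) else if t = k then (k - 1, m - 1) else (k, k + m - t))"
proof (induction t)
  case 0
  then show ?case using k by simp
next
  case (Suc t)
  then have IH: "border k (k + m) D t =
     (if 1 \<notin> A then (if t \<le> k then (t, m) else (k, k + m - t))
      else if t < k then (t, m) else if t = k then (k - 1, m - 1) else (k, k + m - t))" by simp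
  show ?case
  proof (cases "1 \<in> A")
    case False
    then show ?thesis unfolding border.simps(2) IH Let_def boxes_iff using Suc.prems k m by auto
  next
    case True
    consider "Suc t < k" | "Suc t = k" | "t = k" | "t > k" by linarith
    then show ?thesis unfolding border.simps(2) IH Let_def boxes_iff
      by cases (use True Suc.prems k m in auto)
  qed
qed

lemma source_of_row_iff: "source_of_row k (k + m) D t i \<longleftrightarrow> 1 \<le> i \<and> i \<le> k \<and> t = src i"
proof (cases "1 \<le> t \<and> t \<le> k + m")
  case False
  then show ?thesis using k m by (auto simp: source_of_row_def src_def)
next
  case True
  then have t1: "t - 1 \<le> k + m" and t2: "t \<le> k + m" by auto
  show ?thesis
  proof (cases "1 \<in> A")
    case False
    then show ?thesis
      unfolding source_of_row_def src_def border_eq[OF t1] border_eq[OF t2] using True k m by auto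
  next
    case A1: True
    consider "t < k" | "t = k" | "t = Suc k" | "t > Suc k" by linarith
    then show ?thesis
      unfolding source_of_row_def src_def border_eq[OF t1] border_eq[OF t2]
      by cases (use A1 True k m in auto)
  qed
qed

lemma sink_of_column_iff: "sink_of_column k (k + m) D t j \<longleftrightarrow> 1 \<le> j \<and> j \<le> m \<and> t = snk j"
proof (cases "1 \<le> t \<and> t \<le> k + m")
  case False
  then show ?thesis using k m by (auto simp: sink_of_column_def snk_def)
next
  case True
  then have t1: "t - 1 \<le> k + m" and t2: "t \<le> k + m" by auto
  show ?thesis
  proof (cases "1 \<in> A")
    case False
    then show ?thesis
      unfolding sink_of_column_def snk_def border_eq[OF t1] border_eq[OF t2] using True k m by auto
  next
    case A1: True
    consider "t < k" | "t = k" | "t = Suc k" | "t > Suc k" by linarith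
    then show ?thesis
      unfolding sink_of_column_def snk_def border_eq[OF t1] border_eq[OF t2]
      by cases (use A1 True k m in auto)
  qed
qed

lemma sources_eq: "sources k (k + m) D = src ` {1..k}"
  by (auto simp: sources_def source_of_row_iff)

lemma inj_on_src: "inj_on src {1..k}"
  by (auto simp: inj_on_def src_def split: if_splits)

lemma inj_on_snk: "inj_on snk {1..m}"
  using m by (auto simp: inj_on_def snk_def split: if_splits)

lemma src_neq_snk: "i \<in> {1..k} \<Longrightarrow> j \<in> {1..m} \<Longrightarrow> src i \<noteq> snk j"
  by (auto simp: src_def snk_def)

lemma src_in: "i \<in> {1..k} \<Longrightarrow> src i \<in> {1..k + m}"
  using m by (auto simp: src_def)

lemma snk_in: "j \<in> {1..m} \<Longrightarrow> snk j \<in> {1..k + m}"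
  using k by (auto simp: snk_def)

lemma labels_eq: "{1..k + m} = src ` {1..k} \<union> snk ` {1..m}"
proof (rule card_subset_eq[symmetric])
  show "src ` {1..k} \<union> snk ` {1..m} \<subseteq> {1..k + m}" using src_in snk_in by blast
  have "src ` {1..k} \<inter> snk ` {1..m} = {}" using src_neq_snk by auto
  then show "card (src ` {1..k} \<union> snk ` {1..m}) = card {1..k + m}"
    using card_image[OF inj_on_src] card_image[OF inj_on_snk] by (simp add: card_Un_disjoint)
qed simp

text \<open>Left arcs lower the column, down arcs the term \<open>k - i\<close>. Dots lie above the
  sinks because columns start at 1, and below the sources because
  \<open>k - i + j < k + m\<close>.\<close>

definition height :: "vertex \<Rightarrow> nat" where
  "height v = (case v of
     Boundary t \<Rightarrow> if t \<in> src ` {1..k} then k + m + 2 else 0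
   | Internal i j \<Rightarrow> (k - i) + j)"

lemma arc_cases:
  assumes "e \<in> parcs (network k (k + m) D)"
  obtains (source) i j where "i \<in> {1..k}" "e = (Boundary (src i), Internal i j)" "dot i j"
  | (left) i c j where "e = (Internal i c, Internal i j)" "dot i c" "dot i j" "j < c"
  | (down) r j i where "e = (Internal r j, Internal i j)" "dot r j" "dot i j" "r < i"
  | (sink) r j where "e = (Internal r j, Boundary (snk j))" "dot r j"
proof -
  from assms consider "e \<in> left_edges k (k + m) D" | "e \<in> down_edges k (k + m) D"
    by (auto simp: network_def)
  then show thesis
  proof cases
    case 1
    then consider t i j where "e = (Boundary t, Internal i j)" "source_of_row k (k + m) D t i" "rightmost_dot D i j"
      | i c j where "e = (Internal i c, Internal i j)" "(i, c) \<in> dots D" "nearest_dot_left D i c j"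
      unfolding left_edges_def by blast
    then show thesis
      using source left by cases (auto simp: source_of_row_iff rightmost_dot_def nearest_dot_left_def dots_iff)
  next
    case 2
    then consider r j i where "e = (Internal r j, Internal i j)" "(r, j) \<in> dots D" "nearest_dot_below D r j i"
      | r j t where "e = (Internal r j, Boundary t)" "(r, j) \<in> dots D" "sink_of_column k (k + m) D t j"
      unfolding down_edges_def by blast
    then show thesis
      using down sink by cases (auto simp: sink_of_column_iff nearest_dot_below_def dots_iff)
  qed
qed

lemma dot_range: "dot i j \<Longrightarrow> 1 \<le> i \<and> i \<le> k \<and> 1 \<le> j \<and> j \<le> m"
  by (simp add: dot_def)

lemma pverts_network: "pverts (network k (k + m) D) =
    Boundary ` {1..k + m} \<union> {Internal i j | i j. dot i j}"
  by (simp add: network_def dots_iff)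

lemma network_wf:
  assumes "e \<in> parcs (network k (k + m) D)"
  shows "fst e \<in> pverts (network k (k + m) D) \<and> snd e \<in> pverts (network k (k + m) D)"
  using assms
proof (cases rule: arc_cases)
  case (source i j)
  then show ?thesis using src_in[of i] unfolding pverts_network by auto
next
  case (left i c j)
  then show ?thesis unfolding pverts_network by auto
next
  case (down r j i)
  then show ?thesis unfolding pverts_network by auto
next
  case (sink r j)
  then show ?thesis using snk_in[of j] dot_range[of r j] unfolding pverts_network by auto
qed

lemma network_height:
  assumes "e \<in> parcs (network k (k + m) D)"
  shows "height (snd e) < height (fst e)"
  using assms
proof (cases rule: arc_cases)
  case (source i j)
  then show ?thesis using dot_range[of i j] by (auto simp: height_def)
next
  case (left i c j)
  then show ?thesis by (simp add: height_def)
next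
  case (down r j i)
  then have "k - i < k - r" using dot_range[of i j] by linarith
  then show ?thesis unfolding down(1) by (simp add: height_def)
next
  case (sink r j)
  then have "snk j \<notin> src ` {1..k}" using src_neq_snk dot_range[of r j] by fastforce
  then show ?thesis using sink dot_range[of r j] by (simp add: height_def)
qed

sublocale net: acyclic_pair_digraph "network k (k + m) D" height "edge_weight k (k + m) D w"
proof
  have "finite (dots D)" by (rule finite_subset[of _ "{1..k} \<times> {1..m}"]) (auto simp: dots_iff dot_def)
  moreover have "{Internal i j | i j. (i, j) \<in> dots D} = (\<lambda>(i, j). Internal i j) ` dots D" by auto
  ultimately have "finite (pverts (network k (k + m) D))" by (simp add: network_def)
  moreover have "parcs (network k (k + m) D) \<subseteq>
      pverts (network k (k + m) D) \<times> pverts (network k (k + m) D)"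
    using network_wf by (auto simp: mem_Times_iff)
  ultimately show "finite (parcs (network k (k + m) D))"
    using finite_subset finite_cartesian_product by blast
qed (use network_wf network_height in auto)

text \<open>The vertex to which the wire of column \<open>j\<close> leads as it enters row
  \<open>i\<close> from above. It is defined also where the dot is missing, so that rows can be
  compared column by column.\<close>

definition node :: "nat \<Rightarrow> nat \<Rightarrow> vertex" where
  "node i j = (if \<exists>i'\<ge>i. dot i' j then Internal (LEAST i'. i \<le> i' \<and> dot i' j) j
     else Boundary (snk j))"

lemma node_dot: "dot i j \<Longrightarrow> node i j = Internal i j"
  unfolding node_def by (auto intro!: Least_equality)

lemma node_no_dot: "\<not> dot i j \<Longrightarrow> node i j = node (Suc i) j"
proof -
  assume "\<not> dot i j"
  then have "i \<le> i' \<and> dot i' j \<longleftrightarrow> Suc i \<le> i' \<and> dot i' j" for i'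
    by (metis Suc_leD le_less Suc_leI)
  then show ?thesis by (simp add: node_def)
qed

lemma node_last: "node (Suc k) j = Boundary (snk j)"
  using dot_range by (fastforce simp: node_def)

lemma down_edges_iff:
  assumes "dot i j"
  shows "(Internal i j, v) \<in> down_edges k (k + m) D \<longleftrightarrow> v = node (Suc i) j"
proof (cases "\<exists>i'\<ge>Suc i. dot i' j")
  case True
  let ?L = "LEAST i'. Suc i \<le> i' \<and> dot i' j"
  have L: "Suc i \<le> ?L \<and> dot ?L j" using LeastI_ex[OF True] .
  have le: "?L \<le> i'" if "Suc i \<le> i'" "dot i' j" for i'
    using that by (intro Least_le) simp
  have "nearest_dot_below D i j i' \<longleftrightarrow> i' = ?L" for i'
    unfolding nearest_dot_below_def dots_iff using L le by (meson Suc_le_eq le_antisym)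
  then show ?thesis using True assms
    by (auto simp: down_edges_def dots_iff node_def Suc_le_eq)
next
  case False
  then have "\<not> nearest_dot_below D i j i'" for i'
    by (auto simp: nearest_dot_below_def dots_iff Suc_le_eq)
  moreover have "\<forall>i'. i < i' \<longrightarrow> \<not> dot i' j" using False by (simp add: Suc_le_eq)
  ultimately show ?thesis using False assms dot_range[OF assms]
    by (auto simp: down_edges_def dots_iff node_def sink_of_column_iff)
qed

lemma left_edges_iff:
  assumes "dot i j"
  shows "(Internal i j, v) \<in> left_edges k (k + m) D \<longleftrightarrow>
    (\<exists>j'. v = Internal i j' \<and> nearest_dot_left D i j j')"
  using assms by (auto simp: left_edges_def dots_iff)

lemma left_not_down: "(Internal i j, Internal i j') \<notin> down_edges k (k + m) D"
  by (auto simp: down_edges_def nearest_dot_below_def)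

lemma source_edge_iff:
  assumes "i \<in> {1..k}"
  shows "(Boundary (src i), v) \<in> parcs (network k (k + m) D) \<longleftrightarrow>
    (\<exists>j. v = Internal i j \<and> rightmost_dot D i j)"
proof -
  have "(Boundary (src i), v) \<notin> down_edges k (k + m) D" by (auto simp: down_edges_def)
  moreover have "source_of_row k (k + m) D (src i) i' \<longleftrightarrow> i' = i" for i'
    using assms inj_onD[OF inj_on_src, of i i'] by (auto simp: source_of_row_iff)
  ultimately show ?thesis by (auto simp: network_def left_edges_def)
qed

text \<open>With path sums as transfer coefficients, this is the potential induced at
  \<open>v\<close> by the sink values \<open>z\<close>.\<close>

definition weighted_sum :: "(nat \<Rightarrow> real) \<Rightarrow> vertex \<Rightarrow> real" where
  "weighted_sum z v = (\<Sum>c=1..m. net.path_sum v (Boundary (snk c)) * z c)"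

definition U :: "(nat \<Rightarrow> real) \<Rightarrow> nat \<Rightarrow> nat \<Rightarrow> real" where
  "U z i j = weighted_sum z (node i j)"

definition g :: "(nat \<Rightarrow> real) \<Rightarrow> nat \<Rightarrow> real" where
  "g z i = weighted_sum z (Boundary (src i))"

lemma weighted_sum_step:
  assumes "\<And>c. c \<in> {1..m} \<Longrightarrow> v \<noteq> Boundary (snk c)"
  shows "weighted_sum z v = (\<Sum>e\<in>{e \<in> parcs (network k (k + m) D). fst e = v}.
    edge_weight k (k + m) D w e * weighted_sum z (snd e))"
proof -
  have "weighted_sum z v = (\<Sum>c=1..m. \<Sum>e\<in>{e \<in> parcs (network k (k + m) D). fst e = v}.
      edge_weight k (k + m) D w e * (net.path_sum (snd e) (Boundary (snk c)) * z c))"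
    unfolding weighted_sum_def
    by (rule sum.cong) (simp_all add: net.path_sum_step[OF assms] sum_distrib_right mult.assoc)
  also have "\<dots> = (\<Sum>e\<in>{e \<in> parcs (network k (k + m) D). fst e = v}.
      edge_weight k (k + m) D w e * weighted_sum z (snd e))"
    unfolding weighted_sum_def sum_distrib_left by (rule sum.swap)
  finally show ?thesis .
qed

lemma U_dot_left:
  assumes "dot i j" and "nearest_dot_left D i j j'"
  shows "U z i j = w (Internal i j, Internal i j') * U z i j' + U z (Suc i) j"
proof -
  have j': "dot i j'" using assms(2) by (simp add: nearest_dot_left_def dots_iff)
  have "nearest_dot_left D i j x \<longleftrightarrow> x = j'" for x
    using assms(2) by (auto simp: nearest_dot_left_def intro: le_antisym)
  then have "{e \<in> parcs (network k (k + m) D). fst e = Internal i j} =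
      {(Internal i j, Internal i j'), (Internal i j, node (Suc i) j)}"
    using down_edges_iff[OF assms(1)] left_edges_iff[OF assms(1)] by (auto simp: network_def)
  moreover have "edge_weight k (k + m) D w (Internal i j, Internal i j') = w (Internal i j, Internal i j')"
    using left_not_down by (simp add: edge_weight_def)
  moreover have "edge_weight k (k + m) D w (Internal i j, node (Suc i) j) = 1"
    using down_edges_iff[OF assms(1)] by (simp add: edge_weight_def)
  moreover have "Internal i j' \<noteq> node (Suc i) j"
    using down_edges_iff[OF assms(1)] left_not_down by metis
  ultimately show ?thesis
    unfolding U_def node_dot[OF assms(1)] node_dot[OF j'] by (subst weighted_sum_step) auto
qed

lemma U_dot_first:
  assumes "dot i j" and "\<And>j'. j' < j \<Longrightarrow> \<not> dot i j'"
  shows "U z i j = U z (Suc i) j"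
proof -
  have "\<not> nearest_dot_left D i j x" for x
    using assms(2) by (auto simp: nearest_dot_left_def dots_iff)
  then have "{e \<in> parcs (network k (k + m) D). fst e = Internal i j} = {(Internal i j, node (Suc i) j)}"
    using down_edges_iff[OF assms(1)] left_edges_iff[OF assms(1)] by (auto simp: network_def)
  moreover have "edge_weight k (k + m) D w (Internal i j, node (Suc i) j) = 1"
    using down_edges_iff[OF assms(1)] by (simp add: edge_weight_def)
  ultimately show ?thesis
    unfolding U_def node_dot[OF assms(1)] by (subst weighted_sum_step) auto
qed

lemma U_no_dot: "\<not> dot i j \<Longrightarrow> U z i j = U z (Suc i) j"
  by (simp add: U_def node_no_dot)

lemma snk_no_out: 
  assumes "c \<in> {1..m}" and "e \<in> parcs (network k (k + m) D)"
  shows "fst e \<noteq> Boundary (snk c)"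
  using assms(2)
proof (cases rule: arc_cases)
  case (source i j)
  then show ?thesis using src_neq_snk assms(1) by auto
qed auto

lemma U_last:
  assumes "j \<in> {1..m}"
  shows "U z (Suc k) j = z j"
proof -
  have "net.path_sum (Boundary (snk j)) (Boundary (snk c)) * z c = (if c = j then z c else 0)"
    if "c \<in> {1..m}" for c
  proof (cases "c = j")
    case True
    then show ?thesis using net.path_sum_self[of "Boundary (snk j)"] snk_in[OF assms]
      by (simp add: pverts_network)
  next
    case False
    then have "snk j \<noteq> snk c" using inj_on_snk that assms by (auto dest: inj_onD)
    then have "net.path_sum (Boundary (snk j)) (Boundary (snk c)) =
      (\<Sum>e\<in>{e \<in> parcs (network k (k + m) D). fst e = Boundary (snk j)}.
        edge_weight k (k + m) D w e * net.path_sum (snd e) (Boundary (snk c)))"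
      by (intro net.path_sum_step) simp
    also have "{e \<in> parcs (network k (k + m) D). fst e = Boundary (snk j)} = {}"
      using snk_no_out[OF assms] by blast
    finally show ?thesis using False by simp
  qed
  then have "U z (Suc k) j = (\<Sum>c=1..m. if c = j then z c else 0)"
    unfolding U_def weighted_sum_def node_last by (rule sum.cong[OF refl])
  then show ?thesis using assms by (simp add: sum.delta)
qed

lemma g_rightmost:
  assumes "i \<in> {1..k}" and "rightmost_dot D i j"
  shows "g z i = w (Boundary (src i), Internal i j) * U z i j"
proof -
  have ij: "dot i j" using assms(2) by (simp add: rightmost_dot_def dots_iff)
  have "rightmost_dot D i x \<longleftrightarrow> x = j" for x
    using assms(2) by (auto simp: rightmost_dot_def intro: le_antisym)
  then have "{e \<in> parcs (network k (k + m) D). fst e = Boundary (src i)} =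
      {(Boundary (src i), Internal i j)}"
    using source_edge_iff[OF assms(1)] by auto
  moreover have "(Boundary (src i), Internal i j) \<notin> down_edges k (k + m) D"
    by (auto simp: down_edges_def)
  ultimately show ?thesis using src_neq_snk[OF assms(1)]
    unfolding g_def U_def node_dot[OF ij] by (subst weighted_sum_step) (auto simp: edge_weight_def)
qed

lemma g_no_dot:
  assumes "i \<in> {1..k}" and "\<And>j. \<not> dot i j"
  shows "g z i = 0"
proof -
  have "\<not> rightmost_dot D i j" for j using assms(2) by (auto simp: rightmost_dot_def dots_iff)
  then have empty: "{e \<in> parcs (network k (k + m) D). fst e = Boundary (src i)} = {}"
    using source_edge_iff[OF assms(1)] by auto
  have "Boundary (src i) \<noteq> Boundary (snk c)" if "c \<in> {1..m}" for c
    using src_neq_snk[OF assms(1) that] by simp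
  from weighted_sum_step[OF this] show ?thesis unfolding g_def empty by simp
qed

text \<open>In rows from 2 on the dots occupy consecutive columns, so a dot is entered from the
  right either from the source or from the next column. The default 1 keeps \<open>W\<close>
  positive at all other positions.\<close>

definition W :: "nat \<Rightarrow> nat \<Rightarrow> real" where
  "W i j = (if i \<in> {1..k} \<and> rightmost_dot D i j then w (Boundary (src i), Internal i j)
     else if dot i (Suc j) \<and> nearest_dot_left D i (Suc j) j then w (Internal i (Suc j), Internal i j)
     else 1)"

lemma w_pos: "e \<in> left_edges k (k + m) D \<Longrightarrow> w e > 0"
  using weights by (simp add: positive_weights_def)

lemma w_source_pos:
  assumes "i \<in> {1..k}" "rightmost_dot D i j"
  shows "w (Boundary (src i), Internal i j) > 0"
  by (rule w_pos) (use assms in \<open>auto simp: left_edges_def source_of_row_iff\<close>)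

lemma w_left_pos: "dot i c \<Longrightarrow> nearest_dot_left D i c j \<Longrightarrow> w (Internal i c, Internal i j) > 0"
  by (rule w_pos) (simp add: left_edges_iff)

lemma W_pos: "W i j > 0"
  using w_source_pos w_left_pos by (simp add: W_def)

lemma dot_below:
  assumes "2 \<le> i" "i \<le> k"
  shows "dot i j \<longleftrightarrow> 1 \<le> j \<and> j \<le> m \<and> \<not> (i = k \<and> j = m \<and> 1 \<in> A) \<and> \<not> (j = 1 \<and> m + i \<in> A)"
  using assms by (auto simp: dot_def)

lemma U_row:
  assumes "2 \<le> i" "i \<le> k" "1 \<le> j" "j < m"
  shows "U z (Suc i) (Suc j) = U z i (Suc j) -
    (if j = 1 \<and> m + i \<in> A \<or> i = k \<and> Suc j = m \<and> 1 \<in> A then 0 else W i j * U z i j)"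
proof (cases "i = k \<and> Suc j = m \<and> 1 \<in> A")
  case True
  then show ?thesis using U_no_dot[of i "Suc j"] dot_below[of i "Suc j"] assms by auto
next
  case nc: False
  then have dS: "dot i (Suc j)" using dot_below[of i "Suc j"] assms by auto
  show ?thesis
  proof (cases "j = 1 \<and> m + i \<in> A")
    case True
    then have "\<not> dot i j'" if "j' < Suc j" for j'
      using that dot_below[of i j'] assms by (cases "j' = 0") auto
    then show ?thesis using U_dot_first[OF dS] True by simp
  next
    case False
    then have dj: "dot i j" using dot_below[of i j] assms by auto
    then have nl: "nearest_dot_left D i (Suc j) j" by (auto simp: nearest_dot_left_def dots_iff)
    have "\<not> rightmost_dot D i j" using dS by (auto simp: rightmost_dot_def dots_iff)
    then have "W i j = w (Internal i (Suc j), Internal i j)" using nl dS by (simp add: W_def)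
    then show ?thesis using U_dot_left[OF dS nl] False nc by auto
  qed
qed

lemma U_column1:
  assumes "2 \<le> i" "i \<le> k"
  shows "U z (Suc i) 1 = U z i 1"
proof (cases "dot i 1")
  case True
  moreover have "\<not> dot i j" if "j < 1" for j using that dot_range[of i j] by auto
  ultimately show ?thesis using U_dot_first[of i 1] by metis
qed (simp add: U_no_dot)

lemma g_source:
  assumes "2 \<le> i" "i \<le> k"
  shows "g z i = (if i = k \<and> 1 \<in> A then W i (m - 1) * U z i (m - 1) else W i m * U z i m)"
proof -
  have "g z i = W i j * U z i j" if "rightmost_dot D i j" for j
    using g_rightmost[of i j] that assms by (simp add: W_def)
  moreover have "rightmost_dot D i (if i = k \<and> 1 \<in> A then m - 1 else m)"
  proof (cases "i = k \<and> 1 \<in> A")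
    case True
    then have "dot i (m - 1)" using dot_below[OF assms, of "m - 1"] no_wrap m by (auto simp: add.commute)
    moreover have "j \<le> m - 1" if "dot i j" for j
      using that True dot_below[OF assms, of j] by (cases "j = m") auto
    ultimately show ?thesis using True by (auto simp: rightmost_dot_def dots_iff)
  next
    case False
    then have "dot i m" using dot_below[OF assms, of m] m by auto
    then show ?thesis using False dot_range by (auto simp: rightmost_dot_def dots_iff)
  qed
  ultimately show ?thesis by (simp split: if_splits)
qed

text \<open>The dots of row 1 may have gaps, so the induction follows the left arcs from dot to dot:
  each dot contributes its own descent into row 2 and a positive multiple of the form at the next
  dot to the left. The coefficients do not depend on \<open>z\<close>.\<close>

lemma U_top:
  "dot 1 c \<Longrightarrow> \<exists>M. (\<forall>j. dot 1 j \<and> j \<le> c \<longrightarrow> M j > 0) \<and> (\<forall>j. \<not> (dot 1 j \<and> j \<le> c) \<longrightarrow> M j = 0) \<and>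
     (\<forall>z. U z 1 c = (\<Sum>j=1..m. M j * U z 2 j))"
proof (induction c rule: less_induct)
  case (less c)
  have c: "c \<in> {1..m}" using dot_range[OF less.prems] by simp
  show ?case
  proof (cases "\<exists>j<c. dot 1 j")
    case False
    have "(\<Sum>j=1..m. (if j = c then 1 else 0) * U z 2 j) = U z 2 c" for z
      using c by (simp add: if_distrib[of "\<lambda>x. x * _"] sum.delta cong: if_cong)
    then show ?thesis using U_dot_first[OF less.prems] False less.prems
      by (intro exI[of _ "\<lambda>j. if j = c then 1 else 0"]) (auto simp: numeral_2_eq_2)
  next
    case True
    let ?S = "{j. j < c \<and> dot 1 j}"
    have fin: "finite ?S" and ne: "?S \<noteq> {}" using True by auto
    define c' where "c' = Max ?S"
    have c': "c' < c" "dot 1 c'" using Max_in[OF fin ne] by (auto simp: c'_def)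
    have max: "j \<le> c'" if "j < c" "dot 1 j" for j
      using Max_ge[OF fin, of j] that by (simp add: c'_def)
    have nl: "nearest_dot_left D 1 c c'" using c' max by (auto simp: nearest_dot_left_def dots_iff)
    let ?w = "w (Internal 1 c, Internal 1 c')"
    have w: "?w > 0" using w_left_pos[OF less.prems nl] .
    obtain M where M: "\<And>j. dot 1 j \<Longrightarrow> j \<le> c' \<Longrightarrow> M j > 0" "\<And>j. \<not> (dot 1 j \<and> j \<le> c') \<Longrightarrow> M j = 0"
      "\<And>z. U z 1 c' = (\<Sum>j=1..m. M j * U z 2 j)"
      using less.IH[OF c'] by blast
    have "U z 1 c = (\<Sum>j=1..m. (?w * M j + (if j = c then 1 else 0)) * U z 2 j)" for z
    proof -
      have "(\<Sum>j=1..m. (?w * M j + (if j = c then 1 else 0)) * U z 2 j) =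
          ?w * (\<Sum>j=1..m. M j * U z 2 j) + (\<Sum>j=1..m. if j = c then U z 2 j else 0)"
        by (simp add: distrib_right sum.distrib sum_distrib_left mult.assoc
            if_distrib[of "\<lambda>x. x * _"] cong: if_cong)
      then show ?thesis using U_dot_left[OF less.prems nl] M(3) c by (simp add: sum.delta numeral_2_eq_2)
    qed
    moreover have "?w * M j + (if j = c then 1 else 0) > 0" if "dot 1 j" "j \<le> c" for j
    proof (cases "j = c")
      case True
      then have "M j = 0" using M(2)[of j] c' by simp
      then show ?thesis using True by simp
    next
      case False
      then show ?thesis using M(1)[of j] max[of j] that w by simp
    qed
    moreover have "?w * M j + (if j = c then 1 else 0) = 0" if "\<not> (dot 1 j \<and> j \<le> c)" for j
      using M(2)[of j] that c' less.prems by auto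
    ultimately show ?thesis by (intro exI[of _ "\<lambda>j. ?w * M j + (if j = c then 1 else 0)"]) blast
  qed
qed

lemma g_top:
  obtains M where "\<And>j. dot 1 j \<Longrightarrow> M j > 0" "\<And>j. \<not> dot 1 j \<Longrightarrow> M j = 0"
    "\<And>z. g z 1 = (\<Sum>j=1..m. M j * U z 2 j)"
proof (cases "\<exists>j. dot 1 j")
  case False
  then show thesis using that[of "\<lambda>_. 0"] g_no_dot[of 1] k by simp
next
  case True
  have fin: "finite {j. dot 1 j}" by (rule finite_subset[of _ "{1..m}"]) (use dot_range in auto)
  define c where "c = Max {j. dot 1 j}"
  have c: "dot 1 c" using Max_in[OF fin] True by (simp add: c_def)
  have max: "j \<le> c" if "dot 1 j" for j using Max_ge[OF fin, of j] that by (simp add: c_def)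
  have rm: "rightmost_dot D 1 c" using c max by (auto simp: rightmost_dot_def dots_iff)
  have k1: "1 \<in> {1..k}" using k by simp
  let ?w = "w (Boundary (src 1), Internal 1 c)"
  obtain M where M: "\<And>j. dot 1 j \<Longrightarrow> j \<le> c \<Longrightarrow> M j > 0" "\<And>j. \<not> (dot 1 j \<and> j \<le> c) \<Longrightarrow> M j = 0"
    "\<And>z. U z 1 c = (\<Sum>j=1..m. M j * U z 2 j)"
    using U_top[OF c] by blast
  show thesis
  proof (rule that[of "\<lambda>j. ?w * M j"])
    show "?w * M j > 0" if "dot 1 j" for j
      using M(1)[OF that max[OF that]] w_source_pos[OF k1 rm] by simp
    show "?w * M j = 0" if "\<not> dot 1 j" for j using M(2)[of j] that by simp
    show "g z 1 = (\<Sum>j=1..m. ?w * M j * U z 2 j)" for z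
      using g_rightmost[OF k1 rm] M(3) by (simp add: sum_distrib_left mult.assoc)
  qed
qed

text \<open>Passing a row is a unitriangular map, so it can be inverted from the sinks upwards. This
  supplies the kernel vectors that make the minors of the intervals vanish.\<close>

lemma U_surj:
  assumes "2 \<le> i" "i \<le> Suc k"
  shows "\<exists>z. \<forall>j\<in>{1..m}. U z i j = a j"
  using assms(2,1)
proof (induction i arbitrary: a rule: inc_induct)
  case base
  then show ?case using U_last by blast
next
  case (step i)
  \<comment> \<open>The image of \<open>a\<close> under the row relation.\<close>
  define b where "b j = (if j = 1 then a 1 else a j -
    (if j = 2 \<and> m + i \<in> A \<or> i = k \<and> j = m \<and> 1 \<in> A then 0 else W i (j - 1) * a (j - 1)))" for j
  have "\<exists>z. \<forall>j\<in>{1..m}. U z (Suc i) j = b j" using step by simp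
  then obtain z where z: "\<And>j. j \<in> {1..m} \<Longrightarrow> U z (Suc i) j = b j" by blast
  have "U z i j = a j" if "1 \<le> j" "j \<le> m" for j
    using that
  proof (induction j rule: nat_induct_at_least)
    case base
    then show ?case using z[of 1] U_column1[of i z] step m by (simp add: b_def)
  next
    case (Suc j)
    then show ?case using z[of "Suc j"] U_row[of i j z] step
      by (auto simp: b_def numeral_2_eq_2 split: if_splits)
  qed
  then have "\<forall>j\<in>{1..m}. U z i j = a j" by simp
  then show ?case by blast
qed

section \<open>The kernel of the measurement matrix\<close>

lemma meas_eq: "meas k (k + m) D w i j =
  (-1) ^ card {s \<in> sources k (k + m) D. min i j < s \<and> s < max i j} *
    net.path_sum (Boundary i) (Boundary j)"
  by (simp add: meas_def net.path_sum_def net.paths_def sum_distrib_left)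

lemma meas_src:
  assumes "a \<in> {1..k}" "b \<in> {1..k}"
  shows "meas k (k + m) D w (src a) (src b) = (if a = b then 1 else 0)"
proof (cases "a = b")
  case True
  have empty: "{s \<in> sources k (k + m) D. min (src b) (src b) < s \<and> s < max (src b) (src b)} = {}"
    by auto
  show ?thesis using net.path_sum_self[of "Boundary (src b)"] src_in[OF assms(2)]
    unfolding True meas_eq empty by (simp add: pverts_network)
next
  case False
  then have "Boundary (src a) \<noteq> Boundary (src b)" using inj_on_src assms by (auto dest: inj_onD)
  moreover have "snd e \<noteq> Boundary (src b)" if "e \<in> parcs (network k (k + m) D)" for e
    using that
  proof (cases rule: arc_cases)
    case (sink r j)
    then show ?thesis using src_neq_snk[OF assms(2), of j] dot_range[of r j] by auto
  qed auto
  ultimately show ?thesis using False by (simp add: meas_eq net.path_sum_no_in_arcs)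
qed

text \<open>
  With a missing corner, the source of row \<open>k\<close> comes after the sink of column \<open>m\<close>, which therefore
  sees one source fewer than the other sinks.
\<close>

definition sink_sign :: "nat \<Rightarrow> real" where
  "sink_sign c = (if 1 \<in> A \<and> c = m then -1 else 1)"

text \<open>This is the one entry at which the uniform sign rule for the measurement matrix would
  give the wrong sign.\<close>

lemma corner_no_path:
  assumes "1 \<in> A"
  shows "net.path_sum (Boundary (src k)) (Boundary (snk m)) = 0"
proof -
  \<comment> \<open>With value 1 at this sink only, the wires that meet row \<open>k\<close> carry
    0, hence so does its source.\<close>
  define z :: "nat \<Rightarrow> real" where "z c = (if c = m then 1 else 0)" for c
  have last: "U z (Suc k) j = 0" if "1 \<le> j" "j < m" for j
    using U_last[of j z] that by (simp add: z_def)
  have "U z k j = 0" if "1 \<le> j" "j < m" for j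
    using that
  proof (induction j rule: nat_induct_at_least)
    case base
    then show ?case using U_column1[of k z] last[of 1] k by simp
  next
    case (Suc j)
    then show ?case using U_row[of k j z] last[of "Suc j"] k by (simp split: if_splits)
  qed
  then have "g z k = 0" using g_source[of k z] assms k m by simp
  moreover have "g z k = (\<Sum>c=1..m. if c = m then net.path_sum (Boundary (src k)) (Boundary (snk c)) else 0)"
    unfolding g_def weighted_sum_def by (rule sum.cong) (auto simp: z_def)
  moreover have "m \<in> {1..m}" using m by simp
  ultimately show ?thesis by (simp add: sum.delta)
qed

lemma meas_snk:
  assumes a: "a \<in> {1..k}" and c: "c \<in> {1..m}"
  shows "meas k (k + m) D w (src a) (snk c) =
    (-1) ^ (k - a) * sink_sign c * net.path_sum (Boundary (src a)) (Boundary (snk c))"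
proof -
  let ?S = "{s \<in> src ` {1..k}. min (src a) (snk c) < s \<and> s < max (src a) (snk c)}"
  consider "1 \<notin> A" | "1 \<in> A" "c = m" "a = k" | "1 \<in> A" "c = m" "a < k"
    | "1 \<in> A" "c < m" "a = k" | "1 \<in> A" "c < m" "a < k"
    using a c by force
  then have "((-1) ^ card ?S = (-1) ^ (k - a) * sink_sign c) \<or>
      net.path_sum (Boundary (src a)) (Boundary (snk c)) = 0"
  proof cases
    case 1
    then have "?S = {a<..k}" using a c by (auto simp: src_def snk_def)
    then show ?thesis using 1 by (simp add: sink_sign_def)
  next
    case 2
    then show ?thesis using corner_no_path by simp
  next
    case 3
    then have "?S = {a<..<k}" using a c by (auto simp: src_def snk_def image_iff)
    moreover have "k - a = Suc (k - Suc a)" using 3 by simp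
    ultimately show ?thesis using 3 by (simp add: sink_sign_def)
  next
    case 4
    then have empty: "?S = {}" using a c by (auto simp: src_def snk_def)
    show ?thesis unfolding empty using 4 by (simp add: sink_sign_def)
  next
    case 5
    then have "?S = insert (Suc k) {a<..<k}" using a c by (auto simp: src_def snk_def image_iff)
    moreover have "card (insert (Suc k) {a<..<k}) = k - a" using 5 by simp
    ultimately show ?thesis using 5 by (simp add: sink_sign_def)
  qed
  then show ?thesis unfolding meas_eq sources_eq by auto
qed

text \<open>The sign of the exceptional column is moved into the values, so that potentials can be
  taken without signs.\<close>

definition sink_values :: "(nat \<Rightarrow> real) \<Rightarrow> nat \<Rightarrow> real" where
  "sink_values x c = sink_sign c * x (snk c)"

text \<open>The source columns form an identity matrix, so a kernel vector is determined by its sink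
  entries, and its source entries are signed potentials; this is the origin of
  \<open>coord\<close>.\<close>

lemma meas_mult:
  assumes "a \<in> {1..k}"
  shows "(\<Sum>t=1..k + m. meas k (k + m) D w (src a) t * x t) =
    x (src a) + (-1) ^ (k - a) * g (sink_values x) a"
proof -
  let ?M = "\<lambda>t. meas k (k + m) D w (src a) t * x t"
  have "(\<Sum>t=1..k + m. ?M t) = (\<Sum>t\<in>src ` {1..k}. ?M t) + (\<Sum>t\<in>snk ` {1..m}. ?M t)"
    unfolding labels_eq by (rule sum.union_disjoint) (use src_neq_snk in auto)
  also have "(\<Sum>t\<in>src ` {1..k}. ?M t) = (\<Sum>b\<in>{1..k}. ?M (src b))"
    using sum.reindex[OF inj_on_src, of ?M] by simp
  also have "\<dots> = (\<Sum>b\<in>{1..k}. if b = a then x (src b) else 0)"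
    by (rule sum.cong) (use meas_src[OF assms] in auto)
  also have "\<dots> = x (src a)" using assms by (simp add: sum.delta)
  also have "(\<Sum>t\<in>snk ` {1..m}. ?M t) = (\<Sum>c\<in>{1..m}. ?M (snk c))"
    using sum.reindex[OF inj_on_snk, of ?M] by simp
  also have "\<dots> = (\<Sum>c\<in>{1..m}. (-1) ^ (k - a) *
      (net.path_sum (Boundary (src a)) (Boundary (snk c)) * sink_values x c))"
    by (rule sum.cong) (simp_all add: meas_snk[OF assms] sink_values_def)
  also have "\<dots> = (-1) ^ (k - a) * g (sink_values x) a"
    unfolding g_def weighted_sum_def by (simp add: sum_distrib_left)
  finally show ?thesis .
qed

definition in_kernel :: "(nat \<Rightarrow> real) \<Rightarrow> bool" where
  "in_kernel x \<longleftrightarrow> (\<forall>a\<in>{1..k}. (\<Sum>t=1..k + m. meas k (k + m) D w (src a) t * x t) = 0)"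

lemma wire_grid:
  obtains M where "\<And>z. wire_grid k m A W (U z) (g z) M"
proof -
  obtain M where M: "\<And>j. dot 1 j \<Longrightarrow> M j > 0" "\<And>j. \<not> dot 1 j \<Longrightarrow> M j = 0"
    "\<And>z. g z 1 = (\<Sum>j=1..m. M j * U z 2 j)"
    using g_top by blast
  have d1: "dot 1 j \<longleftrightarrow> m + 2 - j \<notin> A" if "1 \<le> j" "j \<le> m" for j
    using that k by (auto simp: dot_def)
  have "wire_grid k m A W (U z) (g z) M" for z
    by unfold_locales
      (use k m no_successor no_wrap W_pos U_row U_column1 g_source M d1 in auto)
  then show thesis using that by blast
qed

lemma coord_src_snk:
  shows "a \<in> {1..k} \<Longrightarrow> wire_grid.coord k m A (U z) (g z) (src a) = - ((-1) ^ (k - a) * g z a)"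
    and "c \<in> {1..m} \<Longrightarrow> wire_grid.coord k m A (U z) (g z) (snk c) = sink_sign c * z c"
proof -
  obtain M where "\<And>z. wire_grid k m A W (U z) (g z) M" using wire_grid by blast
  then interpret wire_grid k m A W "U z" "g z" M .
  show "coord (src a) = - ((-1) ^ (k - a) * g z a)" if "a \<in> {1..k}"
    using that by (auto simp: coord_def src_def)
  show "coord (snk c) = sink_sign c * z c" if "c \<in> {1..m}"
    using that U_last[OF that, of z] by (auto simp: coord_def snk_def sink_sign_def)
qed

lemma weighted_sum_cong:
  "(\<And>c. c \<in> {1..m} \<Longrightarrow> z c = z' c) \<Longrightarrow> weighted_sum z v = weighted_sum z' v"
  unfolding weighted_sum_def by (rule sum.cong) auto

lemma sink_sign_square: "sink_sign c * (sink_sign c * r) = r"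
  by (simp add: sink_sign_def)

lemma coord_eq:
  assumes "in_kernel x" and "t \<in> {1..k + m}"
  shows "wire_grid.coord k m A (U (sink_values x)) (g (sink_values x)) t = x t"
proof -
  have s: "x (src a) = - ((-1) ^ (k - a) * g (sink_values x) a)" if "a \<in> {1..k}" for a
    using assms(1) meas_mult[OF that, of x] that by (simp add: in_kernel_def)
  from assms(2) consider a where "a \<in> {1..k}" "t = src a" | c where "c \<in> {1..m}" "t = snk c"
    unfolding labels_eq by blast
  then show ?thesis
    using s coord_src_snk[of _ "sink_values x"] by cases (auto simp: sink_values_def sink_sign_square)
qed

lemma in_kernel_coord:
  assumes "\<And>t. t \<in> {1..k + m} \<Longrightarrow> x t = wire_grid.coord k m A (U z) (g z) t"
  shows "in_kernel x"
proof -
  have "sink_values x c = z c" if "c \<in> {1..m}" for c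
    using assms[OF snk_in[OF that]] coord_src_snk(2)[OF that, of z]
    by (simp add: sink_values_def sink_sign_square)
  then have "g (sink_values x) a = g z a" for a
    unfolding g_def by (rule weighted_sum_cong)
  then show ?thesis
    using meas_mult[of _ x] assms[OF src_in] coord_src_snk(1)[of _ z] by (simp add: in_kernel_def)
qed

section \<open>Minors and kernel vectors\<close>

lemma sum_over_support:
  fixes f x :: "nat \<Rightarrow> real"
  assumes "J \<subseteq> {1..k + m}" "\<And>t. t \<notin> J \<Longrightarrow> x t = 0"
  shows "(\<Sum>t=1..k + m. f t * x t) = (\<Sum>t\<in>J. f t * x t)"
  by (rule sum.mono_neutral_right) (use assms in auto)

lemma maximal_minor_zero_iff:
  assumes J: "J \<subseteq> {1..k + m}" "card J = k"
  shows "maximal_minor k (k + m) D w J = 0 \<longleftrightarrow>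
    (\<exists>x. in_kernel x \<and> (\<forall>t. t \<notin> J \<longrightarrow> x t = 0) \<and> (\<exists>t\<in>J. x t \<noteq> 0))"
proof -
  let ?L = "sorted_list_of_set J" and ?S = "sorted_list_of_set (sources k (k + m) D)"
  let ?meas = "meas k (k + m) D w"
  let ?B = "mat k k (\<lambda>(a, b). ?meas (?S ! a) (?L ! b))"
  have fin: "finite J" using J finite_subset by blast
  have cS: "card (sources k (k + m) D) = k" unfolding sources_eq using card_image[OF inj_on_src] by simp
  have L: "bij_betw ((!) ?L) {0..<k} J"
    using fin J by (intro bij_betw_nth) (auto simp: length_sorted_list_of_set)
  have S: "bij_betw ((!) ?S) {0..<k} (src ` {1..k})"
    using cS by (intro bij_betw_nth) (auto simp: sources_eq)
  have kernel: "in_kernel x \<longleftrightarrow> (\<forall>a<k. (\<Sum>b<k. ?meas (?S ! a) (?L ! b) * x (?L ! b)) = 0)"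
    if "\<And>t. t \<notin> J \<Longrightarrow> x t = 0" for x
  proof -
    have "(\<Sum>t=1..k + m. ?meas s t * x t) = (\<Sum>b<k. ?meas s (?L ! b) * x (?L ! b))" for s
      using sum_over_support[OF J(1) that, where f = "?meas s"]
        sum.reindex_bij_betw[OF L, of "\<lambda>t. ?meas s t * x t"] by (simp add: lessThan_atLeast0)
    then have "in_kernel x \<longleftrightarrow> (\<forall>s\<in>src ` {1..k}. (\<Sum>b<k. ?meas s (?L ! b) * x (?L ! b)) = 0)"
      by (simp add: in_kernel_def)
    also have "src ` {1..k} = (!) ?S ` {0..<k}" using S by (simp add: bij_betw_def)
    finally show ?thesis by auto
  qed
  have "maximal_minor k (k + m) D w J = 0 \<longleftrightarrow>
      (\<exists>v. v \<in> carrier_vec k \<and> v \<noteq> 0\<^sub>v k \<and> ?B *\<^sub>v v = 0\<^sub>v k)"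
    unfolding maximal_minor_def by (rule det_0_iff_vec_prod_zero) simp
  also have "\<dots> \<longleftrightarrow> (\<exists>x. in_kernel x \<and> (\<forall>t. t \<notin> J \<longrightarrow> x t = 0) \<and> (\<exists>t\<in>J. x t \<noteq> 0))"
  proof
    assume "\<exists>v. v \<in> carrier_vec k \<and> v \<noteq> 0\<^sub>v k \<and> ?B *\<^sub>v v = 0\<^sub>v k"
    then obtain v where v: "v \<in> carrier_vec k" "v \<noteq> 0\<^sub>v k" and Bv: "?B *\<^sub>v v = 0\<^sub>v k" by blast
    \<comment> \<open>\<open>v\<close> is transported along the enumeration of \<open>J\<close> and
      extended by 0.\<close>
    define x where "x t = (if t \<in> J then v $ (the_inv_into {0..<k} ((!) ?L) t) else 0)" for t
    have x: "x (?L ! b) = v $ b" if "b < k" for b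
      using that L by (auto simp: x_def the_inv_into_f_f bij_betw_def)
    have "(\<Sum>b<k. ?meas (?S ! a) (?L ! b) * x (?L ! b)) = (?B *\<^sub>v v) $ a" if "a < k" for a
      using that v(1) x by (auto simp: scalar_prod_def lessThan_atLeast0 intro!: sum.cong)
    then have "in_kernel x" using kernel[of x] Bv by (simp add: x_def)
    moreover obtain b where "b < k" "v $ b \<noteq> 0" using v by (metis carrier_vecD eq_vecI index_zero_vec(1,2))
    then have "\<exists>t\<in>J. x t \<noteq> 0" using x L by (metis atLeast0LessThan bij_betw_apply lessThan_iff)
    moreover have "\<forall>t. t \<notin> J \<longrightarrow> x t = 0" by (simp add: x_def)
    ultimately show "\<exists>x. in_kernel x \<and> (\<forall>t. t \<notin> J \<longrightarrow> x t = 0) \<and> (\<exists>t\<in>J. x t \<noteq> 0)"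
      by blast
  next
    assume "\<exists>x. in_kernel x \<and> (\<forall>t. t \<notin> J \<longrightarrow> x t = 0) \<and> (\<exists>t\<in>J. x t \<noteq> 0)"
    then obtain x t where x: "in_kernel x" "\<And>t. t \<notin> J \<Longrightarrow> x t = 0" and t: "t \<in> J" "x t \<noteq> 0" by blast
    define v where "v = vec k (\<lambda>b. x (?L ! b))"
    have "t \<in> (!) ?L ` {0..<k}" using t(1) L by (simp add: bij_betw_def)
    then obtain b where "b < k" "t = ?L ! b" by auto
    then have "v $ b \<noteq> 0\<^sub>v k $ b" using t by (simp add: v_def)
    then have "v \<noteq> 0\<^sub>v k" by blast
    moreover have "?B *\<^sub>v v = 0\<^sub>v k"
    proof (rule eq_vecI)
      fix a assume "a < dim_vec (0\<^sub>v k :: real vec)"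
      then have "a < k" by simp
      moreover from this have "(?B *\<^sub>v v) $ a = (\<Sum>b<k. ?meas (?S ! a) (?L ! b) * x (?L ! b))"
        by (auto simp: v_def scalar_prod_def lessThan_atLeast0 intro!: sum.cong)
      ultimately show "(?B *\<^sub>v v) $ a = 0\<^sub>v k $ a" using x kernel[of x] by simp
    qed simp
    ultimately show "\<exists>v. v \<in> carrier_vec k \<and> v \<noteq> 0\<^sub>v k \<and> ?B *\<^sub>v v = 0\<^sub>v k"
      by (intro exI[of _ v]) (simp add: v_def)
  qed
  finally show ?thesis .
qed

lemma minor_nonzero:
  assumes J: "J \<subseteq> {1..k + m}" "card J = k" "J \<notin> cyclic_interval k (k + m) ` A"
    and card_interval: "\<And>l. l \<in> A \<Longrightarrow> card (cyclic_interval k (k + m) l) = k"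
  shows "maximal_minor k (k + m) D w J \<noteq> 0"
proof
  assume "maximal_minor k (k + m) D w J = 0"
  then obtain x t where x: "in_kernel x" "\<And>t. t \<notin> J \<Longrightarrow> x t = 0" and t: "t \<in> J" "x t \<noteq> 0"
    using maximal_minor_zero_iff[OF J(1,2)] by blast
  let ?z = "sink_values x"
  obtain M where "\<And>z. wire_grid k m A W (U z) (g z) M" using wire_grid by blast
  then interpret wire_grid k m A W "U ?z" "g ?z" M .
  have coord: "coord t = x t" if "t \<in> {1..k + m}" for t using coord_eq[OF x(1) that] .
  have fin: "finite J" using J finite_subset by blast
  have sub: "coord_support \<subseteq> J" using coord x(2) by (force simp: coord_support_def)
  then have le: "card coord_support \<le> k" using card_mono[OF fin] J(2) by metis
  \<comment> \<open>If all wires entering row 2 were zero, so would be the sink values, and with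
    them all potentials and \<open>x\<close> on \<open>J\<close>.\<close>
  have "\<exists>j. 1 \<le> j \<and> j \<le> m \<and> U ?z 2 j \<noteq> 0"
  proof (rule ccontr)
    assume no: "\<not> ?thesis"
    have z: "?z c = 0" if "c \<in> {1..m}" for c
    proof -
      \<comment> \<open>The empty range from \<open>Suc m\<close> to \<open>m\<close> expresses that
        row 2 is zero.\<close>
      have "Suc m \<le> j \<and> j \<le> m" if "1 \<le> j" "j \<le> m" "U ?z 2 j \<noteq> 0" for j using no that by blast
      then have "Suc m \<le> c" if "U ?z (Suc k) c \<noteq> 0"
        using support_spread[of 2 "Suc m" m "Suc k" c] that \<open>c \<in> {1..m}\<close> k by auto
      then show ?thesis using U_last[OF that, of ?z] that by fastforce
    qed
    then have "weighted_sum ?z v = 0" for v by (simp add: weighted_sum_def)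
    then have "x (src a) = 0" if "a \<in> {1..k}" for a
      using coord[OF src_in[OF that]] coord_src_snk(1)[OF that, of ?z] by (simp add: g_def)
    moreover have "x (snk c) = 0" if "c \<in> {1..m}" for c
      using coord[OF snk_in[OF that]] coord_src_snk(2)[OF that, of ?z] z[OF that] by simp
    moreover have "t \<in> src ` {1..k} \<union> snk ` {1..m}" using t(1) J(1) labels_eq by blast
    ultimately show False using t(2) by auto
  qed
  then obtain j0 where "1 \<le> j0" "j0 \<le> m" "U ?z 2 j0 \<noteq> 0" by blast
  from coord_support_cases[OF this] le obtain l where l: "l \<in> A" "k \<le> card coord_support"
    "coord_support \<subseteq> cyclic_interval k (k + m) l" by auto
  have "finite (cyclic_interval k (k + m) l)" by (simp add: cyclic_interval_def)
  then have "coord_support = cyclic_interval k (k + m) l"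
    using l le card_interval[OF l(1)] by (intro card_subset_eq) auto
  moreover have "coord_support = J" using l le sub J(2) fin by (intro card_subset_eq) auto
  ultimately show False using J(3) l(1) by blast
qed

lemma minor_zero:
  assumes l: "l \<in> A" and card_interval: "card (cyclic_interval k (k + m) l) = k"
  shows "maximal_minor k (k + m) D w (cyclic_interval k (k + m) l) = 0"
proof -
  have range: "1 \<le> l" "l \<le> k + m" using A l by auto
  \<comment> \<open>A unit potential is put on the wire that bypasses the missing dot: in column
    \<open>m\<close> on entering row \<open>k\<close> for the corner, on entering row 2 for a dot of
    the top row, and on entering the row of the dot itself in the rest of the first column.\<close>
  define i where "i = (if l = 1 then k else if l \<le> Suc m then 2 else l - m)"
  define p where "p = (if l = 1 then m else if l \<le> Suc m then m + 2 - l else 1)"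
  have i: "2 \<le> i" "i \<le> k" and p: "1 \<le> p" "p \<le> m" using range k m by (auto simp: i_def p_def)
  have "\<exists>z. \<forall>j\<in>{1..m}. U z i j = (if j = p then 1 else 0)" using U_surj i by simp
  then obtain z where z: "\<And>j. j \<in> {1..m} \<Longrightarrow> U z i j = (if j = p then 1 else 0)" by blast
  obtain M where "\<And>z. wire_grid k m A W (U z) (g z) M" using wire_grid by blast
  then interpret wire_grid k m A W "U z" "g z" M .
  have supp: "t \<in> cyclic_interval k (k + m) l" if t: "1 \<le> t" "t \<le> k + m" "coord t \<noteq> 0" for t
  proof -
    consider "l = 1" | "l \<noteq> 1" "l \<le> Suc m" | "l > Suc m" by linarith
    then show ?thesis
    proof cases
      case 1
      then have "U z k j = 0" if "1 \<le> j" "j < m" for j using z[of j] that by (simp add: i_def p_def)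
      then show ?thesis using support_corner[OF _ _ t] l 1 by simp
    next
      case 2
      have "U z 2 j = 0" if "1 \<le> j" "j \<le> m" "j \<noteq> p" for j using z[of j] that 2 by (simp add: i_def)
      moreover have "m + 2 - p = l" using 2 by (simp add: p_def)
      ultimately show ?thesis using support_top[OF p _ _ t] l by simp
    next
      case 3
      then have "U z (l - m) j = 0" if "2 \<le> j" "j \<le> m" for j using z[of j] that by (simp add: i_def p_def)
      then show ?thesis using support_left[of "l - m", OF _ _ _ _ t] l 3 i by (simp add: i_def)
    qed
  qed
  define x where "x t = (if t \<in> {1..k + m} then coord t else 0)" for t
  have "in_kernel x" by (rule in_kernel_coord) (simp add: x_def)
  moreover have zero: "x t = 0" if "t \<notin> cyclic_interval k (k + m) l" for t
    using supp[of t] that by (auto simp: x_def)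
  \<comment> \<open>If the vector vanished, so would its sink values and every potential, including
    the unit one.\<close>
  moreover have "\<exists>t\<in>cyclic_interval k (k + m) l. x t \<noteq> 0"
  proof (rule ccontr)
    assume "\<not> ?thesis"
    then have x0: "x t = 0" for t using zero by blast
    have "z c = 0" if "c \<in> {1..m}" for c
      using x0[of "snk c"] snk_in[OF that] coord_src_snk(2)[OF that, of z]
      by (auto simp: x_def sink_sign_def split: if_splits)
    then have "weighted_sum z v = 0" for v by (simp add: weighted_sum_def)
    then have "U z i p = 0" by (simp add: U_def)
    then show False using z[of p] p by simp
  qed
  moreover have "cyclic_interval k (k + m) l \<subseteq> {1..k + m}" by (auto simp: cyclic_interval_def)
  ultimately show ?thesis using maximal_minor_zero_iff card_interval by blast
qed

lemma positroid_bases_eq: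
  "positroid_bases k (k + m) D w =
    {J. J \<subseteq> {1..k + m} \<and> card J = k \<and> J \<notin> cyclic_interval k (k + m) ` A}"
proof -
  have "card (cyclic_interval k (k + m) l) = k" if "l \<in> A" for l
    using card_cyclic_interval[of l "k + m" k] A that by auto
  then show ?thesis unfolding positroid_bases_def using minor_nonzero minor_zero by blast
qed

end

theorem theorem4p4:
  fixes n k :: nat and A :: "nat set" and w :: "vertex \<times> vertex \<Rightarrow> real"
  assumes "2 \<le> k" and "k \<le> n - 2"
    and "A \<subseteq> {1..n}" and "nonadjacent n A"
    and "positive_weights k n (diagram_of k n A) w"
  shows "le_diagram k n (diagram_of k n A) \<and>
      sparse_paving {1..n} (positroid_bases k n (diagram_of k n A) w) \<and>
      transversal_matroid {1..n} (positroid_bases k n (diagram_of k n A) w)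
    \<longleftrightarrow> card A \<le> k"
proof -
  obtain m where n: "n = k + m" and m: "2 \<le> m"
    using assms(1,2) that[of "n - k"] by simp
  interpret board k m A w
    using assms m unfolding n by unfold_locales
  let ?C = "cyclic_interval k n"
  have inter: "card (\<Inter>l\<in>L. ?C l) + card L \<le> k" if "L \<subseteq> A" "2 \<le> card L" "card L \<le> k" for L
    using Inter_cyclic_interval[of k n L A] assms m n that by auto
  \<comment> \<open>The case of two intervals gives the bound \<open>k - 2\<close> behind sparse
    paving, and also shows that distinct labels have distinct intervals.\<close>
  have pair: "card (?C l \<inter> ?C l') + 2 \<le> k" if "l \<in> A" "l' \<in> A" "l \<noteq> l'" for l l'
    using inter[of "{l, l'}"] that assms(1) by simp
  have card_C: "card (?C l) = k" if "l \<in> A" for l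
    using card_cyclic_interval[of l n k] assms(3) n that by auto
  have inj: "inj_on ?C A"
  proof (rule inj_onI, rule ccontr)
    fix l l' assume "l \<in> A" "l' \<in> A" "?C l = ?C l'" "l \<noteq> l'"
    then show False using pair[of l l'] card_C[of l'] by simp
  qed
  interpret sparse_family "{1..n}" k "?C ` A"
  proof
    show "Suc (card (H \<inter> H')) < k" if "H \<in> ?C ` A" "H' \<in> ?C ` A" "H \<noteq> H'" for H H'
      using that pair by fastforce
  qed (use assms(1) m n card_C in \<open>auto simp: cyclic_interval_def\<close>)
  have bases: "positroid_bases k n (diagram_of k n A) w = bases"
    unfolding bases_def unfolding n by (rule positroid_bases_eq)
  have finA: "finite A" using assms(3) finite_subset by blast
  have "transversal_matroid {1..n} bases \<longleftrightarrow> card A \<le> k"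
  proof
    assume "transversal_matroid {1..n} bases"
    then show "card A \<le> k" using transversal_imp_card_le card_image[OF inj] by simp
  next
    assume le: "card A \<le> k"
    show "transversal_matroid {1..n} bases"
    proof (rule transversalI)
      show "card (?C ` A) \<le> k" using le card_image[OF inj] by simp
      fix G assume "G \<subseteq> ?C ` A" and G: "2 \<le> card G"
      then obtain L where L: "L \<subseteq> A" "G = ?C ` L" by (auto simp: subset_image_iff)
      then have "card G = card L" using card_image[OF inj_on_subset[OF inj]] by simp
      moreover have "card L \<le> k" using card_mono[OF finA L(1)] le by simp
      ultimately show "card (\<Inter>G) + card G \<le> k" using inter[OF L(1)] G L(2) by simp
    qed (use finA in simp)
  qed
  then show ?thesis
    using le_diagram sparse_paving unfolding bases n[symmetric] by blast
qed


end
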